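(* There exists a constant $A>0$ such that if $m\geq A\ln\ln n$, then w.h.p.\ Maker's graph contains a Hamilton cycle while playing the $(m:1)$ random-Maker game on $E(K_n)$ (against any strategy of Breaker).
   Context: The $(m:1)$ random-Maker game on the board $E(K_n)$: Maker and Breaker alternately claim previously unclaimed edges of $K_n$, Breaker moving first. In each round Breaker claims one unclaimed edge of his choice, and Maker claims $m$ edges chosen uniformly at random among all unclaimed edges; the game continues until all edges are claimed. "W.h.p." means with probability tending to $1$ as $n\to\infty$. *)

theory Defs
  imports "HOL-Probability.Probability" "HOL-Library.Ramsey"
begin

type_synonym edge = "nat set"

text \<open>A history lists the completed rounds in chronological order: the edge claimed by Breaker
  together with the set of edges claimed by Maker in reply.\<close>
type_synonym history = "(edge \<times> edge set) list"

type_synonym strategy = "history \<Rightarrow> edge"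

definition K_edges :: "nat \<Rightarrow> edge set" where
  "K_edges n = [{..<n}]\<^bsup>2\<^esup>"

definition breaker_graph :: "history \<Rightarrow> edge set" where
  "breaker_graph h = fst ` set h"

definition maker_graph :: "history \<Rightarrow> edge set" where
  "maker_graph h = \<Union> (snd ` set h)"

definition unclaimed :: "nat \<Rightarrow> history \<Rightarrow> edge set" where
  "unclaimed n h = K_edges n - (breaker_graph h \<union> maker_graph h)"

definition breaker_strategy :: "nat \<Rightarrow> strategy \<Rightarrow> bool" where
  "breaker_strategy n \<sigma> \<longleftrightarrow> (\<forall>h. unclaimed n h \<noteq> {} \<longrightarrow> \<sigma> h \<in> unclaimed n h)"

text \<open>The minimum matters only in the last round: if fewer than \<open>m\<close> edges are left, Maker
  claims all of them.\<close>
definition maker_move :: "nat \<Rightarrow> edge set \<Rightarrow> edge set pmf" where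
  "maker_move m F = pmf_of_set {M. M \<subseteq> F \<and> card M = min m (card F)}"

definition play_round :: "nat \<Rightarrow> nat \<Rightarrow> strategy \<Rightarrow> history \<Rightarrow> history pmf" where
  "play_round n m \<sigma> h =
     (if unclaimed n h = {} then return_pmf h
      else map_pmf (\<lambda>M. h @ [(\<sigma> h, M)]) (maker_move m (unclaimed n h - {\<sigma> h})))"

primrec play_rounds :: "nat \<Rightarrow> nat \<Rightarrow> strategy \<Rightarrow> nat \<Rightarrow> history pmf" where
  "play_rounds n m \<sigma> 0 = return_pmf []"
| "play_rounds n m \<sigma> (Suc k) = bind_pmf (play_rounds n m \<sigma> k) (play_round n m \<sigma>)"

text \<open>Every round uses up at least Breaker's edge, so the board is exhausted after at most
  \<open>card (K_edges n)\<close> rounds (lemma \<open>random_maker_game_complete\<close> below), and further calls of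
  \<^const>\<open>play_round\<close> change nothing.\<close>
definition random_maker_game :: "nat \<Rightarrow> nat \<Rightarrow> strategy \<Rightarrow> history pmf" where
  "random_maker_game n m \<sigma> = play_rounds n m \<sigma> (card (K_edges n))"

definition is_hamilton_cycle :: "nat set \<Rightarrow> edge set \<Rightarrow> nat list \<Rightarrow> bool" where
  "is_hamilton_cycle V E vs \<longleftrightarrow>
     3 \<le> length vs \<and> distinct vs \<and> set vs = V \<and>
     (\<forall>i<length vs. {vs ! i, vs ! (Suc i mod length vs)} \<in> E)"

definition has_hamilton_cycle :: "nat set \<Rightarrow> edge set \<Rightarrow> bool" where
  "has_hamilton_cycle V E \<longleftrightarrow> (\<exists>vs. is_hamilton_cycle V E vs)"

lemma finite_K_edges: "finite (K_edges n)"
  by (simp add: K_edges_def finite_imp_finite_nsets)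

lemma finite_unclaimed: "finite (unclaimed n h)"
  by (simp add: unclaimed_def finite_K_edges)

lemma set_pmf_maker_move:
  assumes "finite F"
  shows "set_pmf (maker_move m F) = {M. M \<subseteq> F \<and> card M = min m (card F)}"
proof -
  obtain M where "M \<subseteq> F" "card M = min m (card F)"
    using obtain_subset_with_card_n[of "min m (card F)" F] by auto
  then have "{M. M \<subseteq> F \<and> card M = min m (card F)} \<noteq> {}" by blast
  then show ?thesis
    unfolding maker_move_def using assms by (intro set_pmf_of_set) auto
qed

lemma play_rounds_unclaimed:
  assumes \<sigma>: "breaker_strategy n \<sigma>"
  shows "h \<in> set_pmf (play_rounds n m \<sigma> k) \<Longrightarrow> card (unclaimed n h) \<le> card (K_edges n) - k"
proof (induction k arbitrary: h)
  case 0
  then show ?case by (simp add: unclaimed_def breaker_graph_def maker_graph_def)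
next
  case (Suc k)
  then obtain h' where h': "h' \<in> set_pmf (play_rounds n m \<sigma> k)"
    and h: "h \<in> set_pmf (play_round n m \<sigma> h')" by auto
  note IH = Suc.IH[OF h']
  show ?case
  proof (cases "unclaimed n h' = {}")
    case True
    then show ?thesis using h by (simp add: play_round_def)
  next
    case False
    then have e: "\<sigma> h' \<in> unclaimed n h'" using \<sigma> by (simp add: breaker_strategy_def)
    from False h obtain M where "h = h' @ [(\<sigma> h', M)]" by (auto simp: play_round_def)
    then have "unclaimed n h \<subseteq> unclaimed n h' - {\<sigma> h'}"
      by (auto simp: unclaimed_def breaker_graph_def maker_graph_def)
    then have "card (unclaimed n h) \<le> card (unclaimed n h' - {\<sigma> h'})"
      by (intro card_mono) (auto simp: finite_unclaimed)
    also have "\<dots> = card (unclaimed n h') - 1" using e by simp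
    finally show ?thesis using IH by simp
  qed
qed

lemma random_maker_game_complete:
  assumes "breaker_strategy n \<sigma>" and "h \<in> set_pmf (random_maker_game n m \<sigma>)"
  shows "unclaimed n h = {}"
  using play_rounds_unclaimed[OF assms(1), of h m "card (K_edges n)"] assms(2)
  by (simp add: random_maker_game_def finite_unclaimed)

end

theory Submission
  imports Defs "HOL-Real_Asymp.Real_Asymp"
begin

text \<open>Maker's \<open>m\<close> edges of a round are treated as \<open>m\<close> successive uniform picks, and failure
  probabilities are bounded by functions of the position that do not increase under any Breaker move
  and do not increase on average under a single pick of Maker. Put \<open>l = \<lceil>ln n\<rceil>\<close>.

  After \<open>n l\<^sup>2\<close> picks Maker's graph is, w.h.p., an expander: every set \<open>S\<close> of at most \<open>n/4\<close> vertices has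
  more than \<open>2 |S|\<close> outer neighbours. For \<open>|S| \<ge> 8 l\<^sup>2\<close> this is a union bound, since Breaker owns at most
  half of the edges in question. For smaller \<open>S\<close> it follows from minimum degree 12 because no small vertex
  set spans many Maker edges. The minimum degree is where \<open>m \<ge> A ln ln n\<close> enters: a vertex of
  Breaker degree \<open>b\<close> and Maker degree \<open>d < 12\<close> gets weight about \<open>2^-d (e^{\<alpha> b} - 1)\<close> with
  \<open>\<alpha> = m0/(3n)\<close>, \<open>m0 = \<lceil>A ln ln n\<rceil>\<close>. Maker's picks pay for the growth of the weights, so a Breaker edge adds only
  \<open>2 (e^\<alpha> - 1)\<close> to the total. The total therefore stays of order \<open>(ln n)\<^sup>2\<close>, while a vertex about to be
  lost has weight of order \<open>e^{m0/6}\<close>, a larger power of \<open>ln n\<close>.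

  By Posa's rotations a non-Hamiltonian expander has at least \<open>n\<^sup>2/32\<close> boosters, so in the next \<open>n l\<^sup>2\<close>
  picks Maker w.h.p. claims the at most \<open>n\<close> boosters needed.\<close>

section \<open>Expanders and Posa rotations\<close>

definition outer_nbrs :: "edge set \<Rightarrow> nat set \<Rightarrow> nat set" where
  "outer_nbrs M S = {w. w \<notin> S \<and> (\<exists>v\<in>S. {v, w} \<in> M)}"

definition expander :: "nat \<Rightarrow> edge set \<Rightarrow> bool" where
  "expander n M \<longleftrightarrow> (\<forall>S. S \<subseteq> {..<n} \<longrightarrow> S \<noteq> {} \<longrightarrow> card S \<le> n div 4 \<longrightarrow> 2 * card S < card (outer_nbrs M S))"

lemma expanderD:
  "expander n M \<Longrightarrow> S \<subseteq> {..<n} \<Longrightarrow> S \<noteq> {} \<Longrightarrow> card S \<le> n div 4 \<Longrightarrow> 2 * card S < card (outer_nbrs M S)"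
  by (simp add: expander_def)

definition is_path :: "nat \<Rightarrow> edge set \<Rightarrow> nat list \<Rightarrow> bool" where
  "is_path n M p \<longleftrightarrow> p \<noteq> [] \<and> distinct p \<and> set p \<subseteq> {..<n} \<and> successively (\<lambda>x y. {x, y} \<in> M) p"

text \<open>Length is counted in vertices. For \<open>n = 0\<close> there is no path and the
  \<open>Max\<close> is meaningless, hence the assumption \<open>0 < n\<close> below.\<close>

definition path_number :: "nat \<Rightarrow> edge set \<Rightarrow> nat" where
  "path_number n M = Max (length ` Collect (is_path n M))"

fun adjs :: "nat list \<Rightarrow> edge set" where
  "adjs (a # b # r) = insert {a, b} (adjs (b # r))"
| "adjs _ = {}"

text \<open>Posa rotation with the first vertex fixed: the edge from \<open>x\<close> to
  \<open>hd vs\<close> is broken, the edge from \<open>x\<close> to the old end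
  \<open>last vs\<close> is added, and \<open>hd vs\<close> becomes the new end.\<close>

inductive rotated :: "edge set \<Rightarrow> nat list \<Rightarrow> nat list \<Rightarrow> bool" for M P where
  start: "rotated M P P"
| rotate: "rotated M P (us @ x # vs) \<Longrightarrow> vs \<noteq> [] \<Longrightarrow> {x, last vs} \<in> M \<Longrightarrow> rotated M P (us @ x # rev vs)"

lemma K_edges_iff: "{v, w} \<in> K_edges n \<longleftrightarrow> v < n \<and> w < n \<and> v \<noteq> w"
  by (auto simp: K_edges_def nsets_def card_insert_if)

lemma outer_nbrs_subset: "M \<subseteq> K_edges n \<Longrightarrow> outer_nbrs M S \<subseteq> {..<n}"
  by (auto simp: outer_nbrs_def dest!: subsetD simp: K_edges_iff)

lemma outer_nbrs_mono: "M \<subseteq> M' \<Longrightarrow> outer_nbrs M S \<subseteq> outer_nbrs M' S"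
  by (auto simp: outer_nbrs_def)

lemma expander_mono:
  assumes "expander n M" "M \<subseteq> M'" "M' \<subseteq> K_edges n"
  shows "expander n M'"
  unfolding expander_def
proof (intro allI impI)
  fix S assume "S \<subseteq> {..<n}" "S \<noteq> {}" "card S \<le> n div 4"
  then have "2 * card S < card (outer_nbrs M S)" using assms(1) by (simp add: expanderD)
  also have "\<dots> \<le> card (outer_nbrs M' S)"
    using outer_nbrs_mono[OF assms(2)] finite_subset[OF outer_nbrs_subset[OF assms(3)]]
    by (intro card_mono) auto
  finally show "2 * card S < card (outer_nbrs M' S)" .
qed

lemma has_hamilton_cycle_mono: "has_hamilton_cycle V M \<Longrightarrow> M \<subseteq> M' \<Longrightarrow> has_hamilton_cycle V M'"
  unfolding has_hamilton_cycle_def is_hamilton_cycle_def by blast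

section \<open>Longest paths\<close>

lemma is_path_length: "is_path n M p \<Longrightarrow> length p \<le> n"
  by (metis card_lessThan card_mono distinct_card finite_lessThan is_path_def)

lemma is_path_mono: "is_path n M p \<Longrightarrow> M \<subseteq> M' \<Longrightarrow> is_path n M' p"
  by (auto simp: is_path_def intro: successively_mono)

lemma is_path_rev: "is_path n M p \<Longrightarrow> is_path n M (rev p)"
  by (auto simp: is_path_def insert_commute)

lemma finite_path_lengths: "finite (length ` Collect (is_path n M))"
  by (rule finite_subset[of _ "{..n}"]) (auto dest: is_path_length)

lemma path_number_ge: "is_path n M p \<Longrightarrow> length p \<le> path_number n M"
  unfolding path_number_def by (intro Max_ge finite_path_lengths) auto

lemma longest_path_exists:
  assumes "0 < n"
  obtains p where "is_path n M p" "length p = path_number n M"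
proof -
  have "is_path n M [0]" using assms by (simp add: is_path_def)
  then have "path_number n M \<in> length ` Collect (is_path n M)"
    unfolding path_number_def by (intro Max_in finite_path_lengths) auto
  then show ?thesis using that by auto
qed

lemma path_number_mono:
  assumes "M \<subseteq> M'" "0 < n"
  shows "path_number n M \<le> path_number n M'"
  by (metis assms is_path_mono longest_path_exists path_number_ge)

lemma path_number_pos: "0 < n \<Longrightarrow> 0 < path_number n M"
  by (metis is_path_def length_greater_0_conv longest_path_exists)

section \<open>Edges along a path and their change under rotation\<close>

lemma adjs_append: "adjs (us @ x # vs) = adjs (us @ [x]) \<union> adjs (x # vs)"
  by (induction us rule: adjs.induct) auto

lemma adjs_snoc: "us \<noteq> [] \<Longrightarrow> adjs (us @ [x]) = insert {last us, x} (adjs us)"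
  by (induction us rule: adjs.induct) auto

lemma adjs_Cons: "vs \<noteq> [] \<Longrightarrow> adjs (x # vs) = insert {x, hd vs} (adjs vs)"
  by (cases vs) auto

lemma adjs_rev: "adjs (rev vs) = adjs vs"
proof (induction vs)
  case (Cons a vs)
  then show ?case
    by (cases "vs = []") (auto simp: adjs_snoc adjs_Cons last_rev insert_commute)
qed simp

text \<open>Reversing \<open>vs\<close> keeps its adjacent pairs, so a rotation exchanges a single
  edge; the two equations isolate it.\<close>

lemma adjs_rotate:
  assumes "vs \<noteq> []"
  shows "adjs (us @ x # vs) = adjs (us @ [x]) \<union> adjs vs \<union> {{x, hd vs}}"
    and "adjs (us @ x # rev vs) = adjs (us @ [x]) \<union> adjs vs \<union> {{x, last vs}}"
  unfolding adjs_append[of us x vs] adjs_append[of us x "rev vs"]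
  using assms by (auto simp: adjs_Cons adjs_rev hd_rev)

lemma adjs_subset: "e \<in> adjs p \<Longrightarrow> e \<subseteq> set p"
  by (induction p rule: adjs.induct) auto

lemma card_adjs_nbrs:
  assumes "distinct p"
  shows "finite {z. {z, y} \<in> adjs p}" "card {z. {z, y} \<in> adjs p} \<le> 2"
proof -
  have "\<exists>a b. {z. {z, y} \<in> adjs p} \<subseteq> {a, b}"
  proof (cases "y \<in> set p")
    case True
    then obtain us vs where p: "p = us @ y # vs" by (meson split_list)
    have 1: "z = last us" if "{z, y} \<in> adjs (us @ [y])" for z
    proof -
      have "us \<noteq> []" using that by (cases us) auto
      then show ?thesis using that adjs_subset[of "{z,y}" us] assms p by (auto simp: adjs_snoc doubleton_eq_iff)
    qed
    have 2: "z = hd vs" if "{z, y} \<in> adjs (y # vs)" for z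
    proof -
      have "vs \<noteq> []" using that by (cases vs) auto
      then show ?thesis using that adjs_subset[of "{z,y}" vs] assms p by (auto simp: adjs_Cons doubleton_eq_iff)
    qed
    \<comment> \<open>Predecessor and successor of \<open>y\<close>. For empty \<open>us\<close> or
      \<open>vs\<close> the value is arbitrary, which is harmless in an upper bound.\<close>
    have "{z. {z, y} \<in> adjs p} \<subseteq> {last us, hd vs}"
      unfolding p adjs_append[of us y vs] using 1 2 by blast
    then show ?thesis by blast
  next
    case False
    then have "{z. {z, y} \<in> adjs p} = {}" using adjs_subset by blast
    then show ?thesis by simp
  qed
  then obtain a b where *: "{z. {z, y} \<in> adjs p} \<subseteq> {a, b}" by blast
  then show "finite {z. {z, y} \<in> adjs p}" by (rule finite_subset) simp
  have "card {z. {z, y} \<in> adjs p} \<le> card {a, b}" using * by (intro card_mono) auto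
  also have "\<dots> \<le> 2" by (simp add: card_insert_if)
  finally show "card {z. {z, y} \<in> adjs p} \<le> 2" .
qed

lemma rotated_path:
  assumes "rotated M P Q" "is_path n M P"
  shows "is_path n M Q \<and> length Q = length P \<and> hd Q = hd P"
  using assms
proof (induction rule: rotated.induct)
  case (rotate us x vs)
  then have IH: "is_path n M (us @ x # vs)" "length (us @ x # vs) = length P" "hd (us @ x # vs) = hd P" by auto
  have "is_path n M (us @ x # rev vs)"
    using IH(1) rotate.hyps(2,3)
    by (auto simp: is_path_def successively_append_iff successively_Cons hd_rev insert_commute)
  moreover have "hd (us @ x # rev vs) = hd P" using IH(3) by (cases us) auto
  ultimately show ?case using IH(2) by simp
qed simp

text \<open>A vertex that is neither an endpoint of a rotated path nor next to one on \<open>P\<close> never meets a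
  broken or a new edge, so its path neighbours are the same on all rotated paths.\<close>
lemma rotated_adjs:
  assumes "rotated M P Q"
    and "\<And>Q'. rotated M P Q' \<Longrightarrow> z \<noteq> last Q'"
    and "\<And>Q'. rotated M P Q' \<Longrightarrow> {z, last Q'} \<notin> adjs P"
    and "z \<in> e"
  shows "e \<in> adjs Q \<longleftrightarrow> e \<in> adjs P"
  using assms(1,4)
proof (induction arbitrary: e rule: rotated.induct)
  case (rotate us x vs)
  let ?Q = "us @ x # vs" and ?Q' = "us @ x # rev vs"
  have Q': "rotated M P ?Q'" using rotate.hyps by (rule rotated.rotate)
  have hd: "last ?Q' = hd vs" and la: "last ?Q = last vs" using rotate.hyps(2) by (auto simp: last_rev)
  have z: "z \<noteq> hd vs" "z \<noteq> last vs" "{z, hd vs} \<notin> adjs P"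
    using assms(2)[OF Q'] assms(2)[OF rotate.hyps(1)] assms(3)[OF Q'] unfolding hd la by auto
  \<comment> \<open>As pivot, \<open>z\<close> would be next to \<open>hd vs\<close> on
    \<open>?Q\<close>, hence by induction on \<open>P\<close>; but \<open>hd vs\<close> ends the
    rotated path \<open>?Q'\<close>, against the hypothesis on \<open>z\<close>.\<close>
  have "z \<noteq> x"
  proof
    assume "z = x"
    then have "{z, hd vs} \<in> adjs ?Q" by (simp add: adjs_rotate(1)[OF rotate.hyps(2)])
    then show False using rotate.IH[of "{z, hd vs}"] z by simp
  qed
  then have "e \<noteq> {x, hd vs}" "e \<noteq> {x, last vs}" using z rotate.prems by auto
  then have "e \<in> adjs ?Q' \<longleftrightarrow> e \<in> adjs ?Q"
    by (simp add: adjs_rotate[OF rotate.hyps(2)])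
  then show ?case using rotate.IH[OF rotate.prems] by simp
qed simp

text \<open>\<open>R\<close> collects the ends of all rotations of \<open>P\<close>. Every outer
  neighbour of \<open>R\<close> is next on \<open>P\<close> to a member of \<open>R\<close>, and a
  vertex has at most two neighbours on \<open>P\<close>. So \<open>R\<close> has at most
  \<open>2 * card R\<close> outer neighbours, and expansion forces it to be large.\<close>

lemma posa_endpoints:
  assumes M: "M \<subseteq> K_edges n" "expander n M"
    and P: "is_path n M P" "length P = path_number n M"
  shows "\<exists>R. R \<subseteq> {..<n} \<and> n div 4 < card R \<and>
    (\<forall>b\<in>R. \<exists>Q. is_path n M Q \<and> length Q = path_number n M \<and> hd Q = hd P \<and> last Q = b)"
proof -
  define R where "R = last ` {Q. rotated M P Q}"
  have RQ: "is_path n M Q \<and> length Q = path_number n M \<and> hd Q = hd P" if "rotated M P Q" for Q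
    using rotated_path[OF that P(1)] P(2) by simp
  have sub: "R \<subseteq> {..<n}"
  proof
    fix b assume "b \<in> R"
    then obtain Q where "rotated M P Q" "b = last Q" by (auto simp: R_def)
    then show "b \<in> {..<n}" using RQ[of Q] unfolding is_path_def by (metis last_in_set subsetD)
  qed
  then have fin: "finite R" by (rule finite_subset) simp
  have ne: "R \<noteq> {}" by (auto simp: R_def intro: rotated.start)
  have incl: "outer_nbrs M R \<subseteq> (\<Union>y\<in>R. {z. {z, y} \<in> adjs P})"
  proof
    fix z assume "z \<in> outer_nbrs M R"
    then obtain Q where z: "z \<notin> R" "{last Q, z} \<in> M" and Q: "rotated M P Q"
      by (auto simp: outer_nbrs_def R_def)
    note q = RQ[OF Q]
    have zn: "z < n" "z \<noteq> last Q" using z(2) M(1) K_edges_iff by blast+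
    \<comment> \<open>Otherwise \<open>z\<close> could be appended to the longest path
      \<open>Q\<close>.\<close>
    have "z \<in> set Q"
    proof (rule ccontr)
      assume "z \<notin> set Q"
      then have "is_path n M (Q @ [z])" using q zn z(2) by (auto simp: is_path_def successively_append_iff)
      then show False using path_number_ge q by fastforce
    qed
    then obtain us vs where Qe: "Q = us @ z # vs" by (meson split_list)
    have vs: "vs \<noteq> []" using zn(2) Qe by auto
    have zl: "{z, last vs} \<in> M" using z(2) vs Qe by (simp add: insert_commute)
    \<comment> \<open>Rotating \<open>Q\<close> at \<open>z\<close> makes the successor
      \<open>hd vs\<close> of \<open>z\<close> an end.\<close>
    have Q': "rotated M P (us @ z # rev vs)" using rotated.rotate[of M P us z vs] Q zl vs Qe by simp
    have hdR: "hd vs \<in> R" unfolding R_def using Q' vs by (auto intro!: image_eqI[of _ _ "us @ z # rev vs"] simp: last_rev)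
    have adj: "{z, hd vs} \<in> adjs Q" unfolding Qe by (simp add: adjs_rotate(1)[OF vs])
    show "z \<in> (\<Union>y\<in>R. {z. {z, y} \<in> adjs P})"
    proof (rule ccontr)
      assume no: "z \<notin> (\<Union>y\<in>R. {z. {z, y} \<in> adjs P})"
      \<comment> \<open>If \<open>z\<close> were next to no end on \<open>P\<close>,
        \<open>rotated_adjs\<close> would carry this edge from \<open>Q\<close> back to
        \<open>P\<close>, where it does join \<open>z\<close> to an end.\<close>
      have "{z, hd vs} \<in> adjs P"
        using rotated_adjs[OF Q, of z "{z, hd vs}"] adj no z(1) by (auto simp: R_def)
      then show False using no hdR by blast
    qed
  qed
  have dP: "distinct P" using P(1) by (simp add: is_path_def)
  have "card (outer_nbrs M R) \<le> card (\<Union>y\<in>R. {z. {z, y} \<in> adjs P})"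
    using incl fin card_adjs_nbrs(1)[OF dP] by (intro card_mono) auto
  also have "\<dots> \<le> (\<Sum>y\<in>R. card {z. {z, y} \<in> adjs P})" by (rule card_UN_le[OF fin])
  also have "\<dots> \<le> (\<Sum>y\<in>R. 2)" by (intro sum_mono card_adjs_nbrs(2)[OF dP])
  finally have "card (outer_nbrs M R) \<le> 2 * card R" by simp
  then have "n div 4 < card R" using expanderD[OF M(2) sub ne] by linarith
  then show ?thesis using sub RQ by (auto simp: R_def)
qed

section \<open>Connectivity and boosters\<close>

lemma expander_connected:
  assumes M: "expander n M" "M \<subseteq> K_edges n" and n: "9 \<le> n"
    and X: "X \<subseteq> {..<n}" "X \<noteq> {}" "X \<noteq> {..<n}"
  shows "\<exists>x\<in>X. \<exists>w\<in>{..<n} - X. {x, w} \<in> M"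
proof (rule ccontr)
  assume no: "\<not> ?thesis"
  \<comment> \<open>A subset \<open>S\<close> of \<open>Y\<close> of size
    \<open>min (card Y) (n div 4)\<close> has its more than \<open>2 * card S\<close> outer
    neighbours inside \<open>Y - S\<close>, which excludes \<open>S = Y\<close>. If no edge left
    \<open>X\<close>, both \<open>X\<close> and its complement would be such a \<open>Y\<close>, and
    two of them do not fit into \<open>n\<close> vertices.\<close>
  have big: "3 * (n div 4) < card Y"
    if Y: "Y \<subseteq> {..<n}" "Y \<noteq> {}" and cl: "\<And>y w. y \<in> Y \<Longrightarrow> {y, w} \<in> M \<Longrightarrow> w \<in> Y" for Y
  proof -
    have fY: "finite Y" using Y finite_subset by blast
    then obtain S where S: "S \<subseteq> Y" "card S = min (card Y) (n div 4)"
      using obtain_subset_with_card_n[of "min (card Y) (n div 4)" Y] by auto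
    have "0 < card Y" using fY Y by (simp add: card_gt_0_iff)
    then have Sne: "S \<noteq> {}" using S(2) n by (cases "S = {}") auto
    have "S \<subseteq> {..<n}" "card S \<le> n div 4" using S Y by auto
    then have 1: "2 * card S < card (outer_nbrs M S)" using expanderD[OF M(1)] Sne by blast
    have "outer_nbrs M S \<subseteq> Y - S" using cl S(1) by (auto simp: outer_nbrs_def)
    then have "card (outer_nbrs M S) \<le> card (Y - S)" using fY by (intro card_mono) auto
    also have "\<dots> = card Y - card S" using S(1) fY by (intro card_Diff_subset) (auto intro: finite_subset)
    finally show ?thesis using 1 S(2) by (auto simp: min_def split: if_splits)
  qed
  have clM: "y < n" "w < n" if "{y, w} \<in> M" for y w using that M(2) K_edges_iff by blast+
  have no': "y \<in> X \<longleftrightarrow> w \<in> X" if "{y, w} \<in> M" for y w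
    using no clM[OF that] that by (metis DiffI insert_commute lessThan_iff)
  have "3 * (n div 4) < card X" using X(1,2) no' by (intro big) blast+
  moreover have "3 * (n div 4) < card ({..<n} - X)"
  proof (intro big)
    show "{..<n} - X \<noteq> {}" using X(1,3) by blast
    fix y w assume "y \<in> {..<n} - X" "{y, w} \<in> M"
    then show "w \<in> {..<n} - X" using no'[of y w] clM[of y w] by simp
  qed simp
  moreover have "card X + card ({..<n} - X) = n"
    using X(1) card_Diff_subset[of X "{..<n}"] card_mono[of "{..<n}" X] finite_subset[of X "{..<n}"] by simp
  ultimately show False using n by linarith
qed

lemma cyclic_nth_if_path:
  assumes "successively (\<lambda>x y. {x, y} \<in> M) p" "{hd p, last p} \<in> M" "p \<noteq> []" "i < length p"
  shows "{p ! i, p ! (Suc i mod length p)} \<in> M"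
proof (cases "Suc i < length p")
  case True
  then show ?thesis using assms(1) by (simp add: successively_conv_nth)
next
  case False
  then have "Suc i = length p" using assms(4) by simp
  then have "i = length p - 1" by simp
  then show ?thesis using assms by (simp add: hd_conv_nth last_conv_nth insert_commute)
qed

text \<open>The new edge closes \<open>Q\<close> to a cycle. If the cycle is not spanning,
  connectivity gives an edge of \<open>M\<close> leaving it, and opening the cycle next to that edge
  yields a longer path.\<close>

lemma closing_longest_path:
  assumes M: "expander n M" "M \<subseteq> K_edges n" and n: "9 \<le> n"
    and Q: "is_path n M Q" "length Q = path_number n M"
  defines "M' \<equiv> insert {hd Q, last Q} M"
  shows "has_hamilton_cycle {..<n} M' \<or> path_number n M < path_number n M'"
proof (cases "set Q = {..<n}")
  case True
  have "length Q = n" using True Q(1) distinct_card[of Q] by (simp add: is_path_def)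
  moreover have "successively (\<lambda>x y. {x, y} \<in> M') Q"
    using Q(1) is_path_mono[of n M Q M'] by (auto simp: is_path_def M'_def)
  moreover have Qd: "Q \<noteq> []" "distinct Q" using Q(1) by (auto simp: is_path_def)
  moreover have "{hd Q, last Q} \<in> M'" by (simp add: M'_def)
  ultimately have "is_hamilton_cycle {..<n} M' Q"
    using True n cyclic_nth_if_path[of M' Q] unfolding is_hamilton_cycle_def by simp
  then show ?thesis by (auto simp: has_hamilton_cycle_def)
next
  case False
  then obtain x w where x: "x \<in> set Q" and w: "w < n" "w \<notin> set Q" "{x, w} \<in> M"
    using expander_connected[OF M n, of "set Q"] Q(1) by (auto simp: is_path_def)
  obtain us vs where Qe: "Q = us @ x # vs" using x by (meson split_list)
  have "is_path n M' Q" using Q(1) is_path_mono[of n M Q M'] by (auto simp: M'_def)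
  \<comment> \<open>From \<open>w\<close> to \<open>x\<close>, along \<open>vs\<close> to the end of
    \<open>Q\<close>, over the new edge to its start, and along \<open>us\<close> up to just before
    \<open>x\<close>.\<close>
  then have "is_path n M' (w # x # vs @ us)"
    using w unfolding Qe
    by (cases "us = []"; cases "vs = []")
       (auto simp: is_path_def successively_append_iff successively_Cons M'_def insert_commute Qe)
  then have "length (w # x # vs @ us) \<le> path_number n M'" by (rule path_number_ge)
  then show ?thesis using Q(2) Qe by simp
qed

definition boosters :: "nat \<Rightarrow> edge set \<Rightarrow> edge set" where
  "boosters n M = {e \<in> K_edges n. has_hamilton_cycle {..<n} (insert e M) \<or> path_number n M < path_number n (insert e M)}"

text \<open>Rotations of a longest path yield more than \<open>n div 4\<close> ends. Reversing a
  path with end \<open>a\<close> and rotating again yields more than \<open>n div 4\<close> partners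
  for each \<open>a\<close>. Every such pair is a booster by \<open>closing_longest_path\<close>,
  and an edge arises from at most two ordered pairs: (n/4)^2 / 2 = n^2/32.\<close>

lemma card_boosters:
  assumes M: "expander n M" "M \<subseteq> K_edges n" and n: "9 \<le> n"
  shows "real n ^ 2 / 32 \<le> real (card (boosters n M))"
proof -
  define E where "E = {(hd Q, last Q) | Q. is_path n M Q \<and> length Q = path_number n M}"
  have EI: "(hd Q, last Q) \<in> E" if "is_path n M Q" "length Q = path_number n M" for Q
    using that by (auto simp: E_def)
  \<comment> \<open>A neighbour of vertex 0 gives a path on two vertices, so the two ends of a
    longest path differ.\<close>
  have "2 * card {0::nat} < card (outer_nbrs M {0})"
    using n by (intro expanderD[OF M(1)]) auto
  then have "outer_nbrs M {0} \<noteq> {}" by auto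
  then obtain w where w: "{0, w} \<in> M" by (auto simp: outer_nbrs_def)
  then have "{0, w} \<in> K_edges n" using M(2) by blast
  then have "is_path n M [0, w]" using w by (auto simp: is_path_def K_edges_iff)
  then have len2: "2 \<le> path_number n M" using path_number_ge by fastforce
  have Esub: "a < n \<and> b < n \<and> a \<noteq> b \<and> {a, b} \<in> boosters n M" if ab: "(a, b) \<in> E" for a b
  proof -
    obtain Q where Q: "is_path n M Q" "length Q = path_number n M" "a = hd Q" "b = last Q"
      using ab by (auto simp: E_def)
    obtain y ys where y: "Q = y # ys" using Q(2) len2 by (cases Q) auto
    then have ys: "ys \<noteq> []" using Q(2) len2 by auto
    then have "last ys \<in> set ys" by simp
    then have "a < n" "b < n" "a \<noteq> b" using Q y ys by (auto simp: is_path_def simp del: last_in_set)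
    then show ?thesis using closing_longest_path[OF M n Q(1,2)] Q(3,4)
      by (auto simp: boosters_def K_edges_iff)
  qed
  have Efin: "finite E" by (rule finite_subset[of _ "{..<n} \<times> {..<n}"]) (use Esub in auto)
  obtain P where P: "is_path n M P" "length P = path_number n M" using longest_path_exists[of n M] n by auto
  obtain R where R: "R \<subseteq> {..<n}" "n div 4 < card R"
    "\<And>b. b \<in> R \<Longrightarrow> \<exists>Q. is_path n M Q \<and> length Q = path_number n M \<and> hd Q = hd P \<and> last Q = b"
    using posa_endpoints[OF M(2,1) P] by blast
  have fR: "finite R" using R(1) finite_subset by blast
  have ex: "\<exists>R'. R' \<subseteq> {..<n} \<and> n div 4 < card R' \<and> (\<forall>b\<in>R'. (a, b) \<in> E)" if a: "a \<in> R" for a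
  proof -
    obtain Q where Q: "is_path n M Q" "length Q = path_number n M" "last Q = a" using R(3)[OF a] by blast
    \<comment> \<open>Reversal makes \<open>a\<close> the fixed first vertex of a new family of
      rotations.\<close>
    have "is_path n M (rev Q)" "length (rev Q) = path_number n M" "hd (rev Q) = a"
      using Q is_path_rev by (auto simp: hd_rev)
    from posa_endpoints[OF M(2,1) this(1,2)] this(3) show ?thesis using EI by (metis (no_types))
  qed
  then obtain R' where R': "\<And>a. a \<in> R \<Longrightarrow> R' a \<subseteq> {..<n} \<and> n div 4 < card (R' a) \<and> (\<forall>b\<in>R' a. (a, b) \<in> E)"
    by metis
  let ?k = "n div 4 + 1"
  have "?k * ?k \<le> card R * ?k" using R(2) by (intro mult_right_mono) auto
  also have "\<dots> = (\<Sum>a\<in>R. ?k)" by simp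
  also have "\<dots> \<le> (\<Sum>a\<in>R. card (R' a))" using R' by (intro sum_mono) (simp add: Suc_le_eq)
  also have "\<dots> = card (Sigma R R')" using fR R' by (intro card_SigmaI[symmetric]) (auto intro: finite_subset)
  also have "\<dots> \<le> card E" using R' Efin by (intro card_mono) auto
  finally have k2: "?k * ?k \<le> card E" .
  let ?f = "\<lambda>(a, b). {a, b} :: nat set"
  have bfin: "finite (boosters n M)" using finite_K_edges by (auto simp: boosters_def)
  have "E \<subseteq> (\<Union>e\<in>boosters n M. {x. ?f x = e})" using Esub by auto
  moreover have fib: "finite {x. ?f x = e} \<and> card {x. ?f x = e} \<le> 2" if "e \<in> boosters n M" for e
  proof -
    obtain a b where e: "e = {a, b}" using \<open>e \<in> boosters n M\<close>
      by (auto simp: boosters_def K_edges_def nsets_def card_2_iff)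
    have sub: "{x. ?f x = e} \<subseteq> {(a, b), (b, a)}"
    proof
      fix x assume "x \<in> {x. ?f x = e}"
      moreover obtain p q where "x = (p, q)" by fastforce
      ultimately show "x \<in> {(a, b), (b, a)}" unfolding e by (simp add: doubleton_eq_iff)
    qed
    have "card {(a, b), (b, a)} \<le> 2" using card_length[of "[(a, b), (b, a)]"] by simp
    moreover have "card {x. ?f x = e} \<le> card {(a, b), (b, a)}" by (intro card_mono sub) simp
    ultimately have "card {x. ?f x = e} \<le> 2" by (rule le_trans[rotated])
    then show ?thesis using finite_subset[OF sub] by simp
  qed
  ultimately have "card E \<le> card (\<Union>e\<in>boosters n M. {x. ?f x = e})" using bfin by (intro card_mono) auto
  also have "\<dots> \<le> (\<Sum>e\<in>boosters n M. card {x. ?f x = e})" by (rule card_UN_le[OF bfin])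
  also have "\<dots> \<le> (\<Sum>e\<in>boosters n M. 2)" using fib by (intro sum_mono) auto
  finally have "card E \<le> 2 * card (boosters n M)" by simp
  with k2 have "?k * ?k \<le> 2 * card (boosters n M)" by linarith
  then have "real ?k * real ?k \<le> 2 * real (card (boosters n M))" by (metis of_nat_le_iff of_nat_mult of_nat_numeral)
  moreover have "(real n / 4) * (real n / 4) \<le> real ?k * real ?k"
    by (intro mult_mono) linarith+
  ultimately show ?thesis by (simp add: power2_eq_square)
qed

section \<open>Sequential form of Maker's moves\<close>

lemma maker_move_0: "finite F \<Longrightarrow> maker_move 0 F = return_pmf {}"
proof -
  assume "finite F"
  then have "{M. M \<subseteq> F \<and> card M = 0} = {{}}" by (auto dest: finite_subset)
  then show ?thesis by (simp add: maker_move_def pmf_of_set_singleton)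
qed

lemma expectation_maker_move:
  fixes f :: "edge set \<Rightarrow> real"
  assumes "finite F"
  shows "measure_pmf.expectation (maker_move j F) f =
    (\<Sum>X\<in>{X. X \<subseteq> F \<and> card X = min j (card F)}. f X) / real (card F choose min j (card F))"
proof -
  have "{X. X \<subseteq> F \<and> card X = min j (card F)} \<noteq> {}"
    using set_pmf_maker_move[OF assms, of j] set_pmf_not_empty[of "maker_move j F"] by simp
  then show ?thesis using assms n_subsets[OF assms]
    unfolding maker_move_def by (subst integral_pmf_of_set) auto
qed

text \<open>A uniform set of \<open>Suc j\<close> edges is a uniform first pick followed by a
  uniform set of \<open>j\<close> others; the proof counts pairs of a set and one of its members in
  two ways.\<close>

lemma expectation_maker_move_Suc:
  fixes f :: "edge set \<Rightarrow> real"
  assumes F: "finite F" "F \<noteq> {}"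
  shows "real (card F) * measure_pmf.expectation (maker_move (Suc j) F) f =
    (\<Sum>e\<in>F. measure_pmf.expectation (maker_move j (F - {e})) (\<lambda>X. f (insert e X)))"
proof -
  obtain c where c: "card F = Suc c" using F by (metis card_0_eq not0_implies_Suc)
  define k where "k = min j c"
  have mk: "min (Suc j) (card F) = Suc k" "k \<le> c" by (auto simp: c k_def)
  have ce: "card (F - {e}) = c" if "e \<in> F" for e using that F c by simp
  let ?S = "\<lambda>k F. {X. X \<subseteq> F \<and> card X = k}"
  have finS: "finite (?S k F)" for k using F(1) by simp
  have inner: "(\<Sum>X\<in>?S k (F - {e}). f (insert e X)) = (\<Sum>X\<in>{X \<in> ?S (Suc k) F. e \<in> X}. f X)" if e: "e \<in> F" for e
  proof (rule sum.reindex_bij_witness[of _ "\<lambda>X. X - {e}" "insert e"])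
    fix X assume "X \<in> ?S k (F - {e})"
    then have "finite X" "e \<notin> X" "X \<subseteq> F" "card X = k" using F(1) finite_subset by auto
    then show "insert e X - {e} = X" "insert e X \<in> {X \<in> ?S (Suc k) F. e \<in> X}" using e by auto
  next
    fix X assume "X \<in> {X \<in> ?S (Suc k) F. e \<in> X}"
    then show "insert e (X - {e}) = X" "X - {e} \<in> ?S k (F - {e})" using F(1) finite_subset[of X F] by auto
  qed simp
  have "(\<Sum>e\<in>F. \<Sum>X\<in>?S k (F - {e}). f (insert e X)) = (\<Sum>e\<in>F. \<Sum>X\<in>{X \<in> ?S (Suc k) F. e \<in> X}. f X)"
    by (intro sum.cong inner refl)
  also have "\<dots> = (\<Sum>X\<in>?S (Suc k) F. \<Sum>e\<in>{e \<in> F. e \<in> X}. f X)"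
    by (rule sum.swap_restrict[OF F(1) finS])
  also have "\<dots> = (\<Sum>X\<in>?S (Suc k) F. real (Suc k) * f X)"
  proof (intro sum.cong refl)
    fix X assume X: "X \<in> ?S (Suc k) F"
    then have "{e \<in> F. e \<in> X} = X" by auto
    then show "(\<Sum>e\<in>{e \<in> F. e \<in> X}. f X) = real (Suc k) * f X" using X by simp
  qed
  finally have main: "(\<Sum>e\<in>F. \<Sum>X\<in>?S k (F - {e}). f (insert e X)) = real (Suc k) * (\<Sum>X\<in>?S (Suc k) F. f X)"
    by (simp add: sum_distrib_left)
  \<comment> \<open>Absorption identity; it converts the number of smaller moves into the number of
    larger ones.\<close>
  have bin: "real (Suc k) * real (Suc c choose Suc k) = real (Suc c) * real (c choose k)"
    by (metis Suc_times_binomial of_nat_mult)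
  have pos: "0 < real (c choose k)" "0 < real (Suc c choose Suc k)" using mk(2) by (simp_all add: zero_less_binomial del: binomial_Suc_Suc)
  have "(\<Sum>e\<in>F. measure_pmf.expectation (maker_move j (F - {e})) (\<lambda>X. f (insert e X)))
     = (\<Sum>e\<in>F. (\<Sum>X\<in>?S k (F - {e}). f (insert e X)) / real (c choose k))"
    using F(1) by (intro sum.cong refl) (simp add: expectation_maker_move ce k_def c)
  also have "\<dots> = real (Suc k) * (\<Sum>X\<in>?S (Suc k) F. f X) / real (c choose k)"
    by (simp add: main sum_divide_distrib[symmetric])
  also have "\<dots> = real (Suc c) * ((\<Sum>X\<in>?S (Suc k) F. f X) / real (Suc c choose Suc k))"
  proof -
    have "a * s / p = b * (s / q)" if "a * q = b * p" "0 < p" "0 < q" for a b p q s :: real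
    proof -
      have "a * s / p = (a * q) * s / (p * q)" using that(3) by simp
      also have "\<dots> = b * (s / q)" unfolding that(1) using that(2) by simp
      finally show ?thesis .
    qed
    from this[OF bin pos] show ?thesis .
  qed
  also have "\<dots> = real (card F) * measure_pmf.expectation (maker_move (Suc j) F) f"
    using F(1) mk by (simp add: expectation_maker_move c del: binomial_Suc_Suc)
  finally show ?thesis by simp
qed

section \<open>Supermartingale bound\<close>

text \<open>\<open>j\<close> picks of the current round are left, and every Breaker edge entitles
  Maker to \<open>m\<close> picks, which gives the last equation. At \<open>j = 0\<close> Breaker is
  to move.\<close>

definition position :: "nat \<Rightarrow> nat \<Rightarrow> edge set \<Rightarrow> edge set \<Rightarrow> nat \<Rightarrow> bool" where
  "position n m B M j \<longleftrightarrow> B \<subseteq> K_edges n \<and> M \<subseteq> K_edges n \<and> B \<inter> M = {} \<and> j \<le> m \<and> card M + j = m * card B"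

text \<open>In \<open>\<Psi> j B M\<close> the number \<open>j\<close> counts the picks that Maker still has in the current round.\<close>
definition supermartingale ::
  "nat \<Rightarrow> nat \<Rightarrow> nat \<Rightarrow> nat \<Rightarrow> (nat \<Rightarrow> edge set \<Rightarrow> edge set \<Rightarrow> real) \<Rightarrow> bool" where
  "supermartingale n m L0 L \<Psi> \<longleftrightarrow>
    (\<forall>B M e. position n m B M 0 \<longrightarrow> L0 \<le> card M \<longrightarrow> card M < L \<longrightarrow> e \<in> K_edges n - (B \<union> M) \<longrightarrow>
       \<Psi> m (insert e B) M \<le> \<Psi> 0 B M) \<and>
    (\<forall>B M j. position n m B M (Suc j) \<longrightarrow> L0 \<le> card M \<longrightarrow> card M < L \<longrightarrow>
       (\<Sum>e\<in>K_edges n - (B \<union> M). \<Psi> j B (insert e M)) \<le> real (card (K_edges n - (B \<union> M))) * \<Psi> (Suc j) B M)"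

lemma supermartingaleI:
  assumes "\<And>B M e. position n m B M 0 \<Longrightarrow> L0 \<le> card M \<Longrightarrow> card M < L \<Longrightarrow> e \<in> K_edges n - (B \<union> M) \<Longrightarrow>
       \<Psi> m (insert e B) M \<le> \<Psi> 0 B M"
    and "\<And>B M j. position n m B M (Suc j) \<Longrightarrow> L0 \<le> card M \<Longrightarrow> card M < L \<Longrightarrow>
       (\<Sum>e\<in>K_edges n - (B \<union> M). \<Psi> j B (insert e M)) \<le> real (card (K_edges n - (B \<union> M))) * \<Psi> (Suc j) B M"
  shows "supermartingale n m L0 L \<Psi>"
  using assms unfolding supermartingale_def by blast

lemma supermartingale_breaker:
  "supermartingale n m L0 L \<Psi> \<Longrightarrow> position n m B M 0 \<Longrightarrow> L0 \<le> card M \<Longrightarrow> card M < L \<Longrightarrow> e \<in> K_edges n - (B \<union> M) \<Longrightarrow>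
       \<Psi> m (insert e B) M \<le> \<Psi> 0 B M"
  unfolding supermartingale_def by blast

lemma supermartingale_maker:
  "supermartingale n m L0 L \<Psi> \<Longrightarrow> position n m B M (Suc j) \<Longrightarrow> L0 \<le> card M \<Longrightarrow> card M < L \<Longrightarrow>
    (\<Sum>e\<in>K_edges n - (B \<union> M). \<Psi> j B (insert e M)) \<le> real (card (K_edges n - (B \<union> M))) * \<Psi> (Suc j) B M"
  unfolding supermartingale_def by blast

lemma supermartingale_add:
  assumes "supermartingale n m L0 L \<Psi>" "supermartingale n m L0 L \<Psi>'"
  shows "supermartingale n m L0 L (\<lambda>j B M. \<Psi> j B M + \<Psi>' j B M)"
proof (rule supermartingaleI)
  fix B M e assume "position n m B M 0" "L0 \<le> card M" "card M < L" "e \<in> K_edges n - (B \<union> M)"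
  then show "\<Psi> m (insert e B) M + \<Psi>' m (insert e B) M \<le> \<Psi> 0 B M + \<Psi>' 0 B M"
    by (intro add_mono supermartingale_breaker[OF assms(1)] supermartingale_breaker[OF assms(2)])
next
  fix B M j assume "position n m B M (Suc j)" "L0 \<le> card M" "card M < L"
  from supermartingale_maker[OF assms(1) this] supermartingale_maker[OF assms(2) this]
  show "(\<Sum>e\<in>K_edges n - (B \<union> M). \<Psi> j B (insert e M) + \<Psi>' j B (insert e M))
      \<le> real (card (K_edges n - (B \<union> M))) * (\<Psi> (Suc j) B M + \<Psi>' (Suc j) B M)"
    by (simp add: sum.distrib distrib_left)
qed

lemma supermartingale_sum:
  assumes "\<And>i. i \<in> I \<Longrightarrow> supermartingale n m L0 L (\<Psi> i)"
  shows "supermartingale n m L0 L (\<lambda>j B M. \<Sum>i\<in>I. \<Psi> i j B M)"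
  using assms
proof (induction I rule: infinite_finite_induct)
  case (insert x I)
  then show ?case using supermartingale_add[of n m L0 L "\<Psi> x" "\<lambda>j B M. \<Sum>i\<in>I. \<Psi> i j B M"] by simp
qed (auto simp: supermartingale_def)

lemma supermartingale_const: "supermartingale n m L0 L (\<lambda>j B M. c)"
  by (auto simp: supermartingale_def)

lemma finite_position: "position n m B M j \<Longrightarrow> finite B \<and> finite M"
  unfolding position_def using finite_K_edges finite_subset by metis

text \<open>All rounds but the current one are complete, and \<open>j \<le> m\<close> bounds what is
  missing from that one.\<close>

lemma position_card:
  assumes "position n m B M j" "0 < m"
  shows "card B \<le> card M + 1" "m * (card B - 1) \<le> card M"
proof -
  show *: "m * (card B - 1) \<le> card M"
    using assms unfolding position_def by (cases "card B") auto
  have "card B - 1 \<le> m * (card B - 1)" using assms(2) by simp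
  then show "card B \<le> card M + 1" using * by linarith
qed

lemma position_pick:
  assumes "position n m B M (Suc j)" "e \<in> K_edges n - (B \<union> M)"
  shows "position n m B (insert e M) j" "card (insert e M) = Suc (card M)"
  using assms finite_position[OF assms(1)] by (auto simp: position_def)

text \<open>Maker's graph grows by one edge per pick, so the change of potential happens at a pick
  that ends with exactly \<open>L1\<close> Maker edges, where \<open>\<Psi>'\<close> is the smaller
  one.\<close>

lemma supermartingale_append:
  assumes 1: "supermartingale n m L0 L1 \<Psi>" and 2: "supermartingale n m L1 L2 \<Psi>'"
    and le: "\<And>j B M. position n m B M j \<Longrightarrow> card M = L1 \<Longrightarrow> \<Psi>' j B M \<le> \<Psi> j B M"
  shows "supermartingale n m L0 L2 (\<lambda>j B M. if card M < L1 then \<Psi> j B M else \<Psi>' j B M)"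
proof (rule supermartingaleI)
  fix B M e assume "position n m B M 0" "L0 \<le> card M" "card M < L2" "e \<in> K_edges n - (B \<union> M)"
  then show "(if card M < L1 then \<Psi> m (insert e B) M else \<Psi>' m (insert e B) M) \<le> (if card M < L1 then \<Psi> 0 B M else \<Psi>' 0 B M)"
    using supermartingale_breaker[OF 1] supermartingale_breaker[OF 2] by simp
next
  fix B M j assume pos: "position n m B M (Suc j)" and M: "L0 \<le> card M" "card M < L2"
  let ?F = "K_edges n - (B \<union> M)"
  let ?g = "\<lambda>e. if card (insert e M) < L1 then \<Psi> j B (insert e M) else \<Psi>' j B (insert e M)"
  show "(\<Sum>e\<in>?F. ?g e) \<le> real (card ?F) * (if card M < L1 then \<Psi> (Suc j) B M else \<Psi>' (Suc j) B M)"
  proof (cases "card M < L1")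
    case True
    have "(\<Sum>e\<in>?F. ?g e) \<le> (\<Sum>e\<in>?F. \<Psi> j B (insert e M))"
    proof (rule sum_mono)
      fix e assume e: "e \<in> ?F"
      show "?g e \<le> \<Psi> j B (insert e M)"
        using le[OF position_pick(1)[OF pos e]] position_pick(2)[OF pos e] True by auto
    qed
    also have "\<dots> \<le> real (card ?F) * \<Psi> (Suc j) B M"
      using supermartingale_maker[OF 1 pos] M True by simp
    finally show ?thesis using True by simp
  next
    case False
    have "(\<Sum>e\<in>?F. ?g e) = (\<Sum>e\<in>?F. \<Psi>' j B (insert e M))"
      using False position_pick(2)[OF pos] by (intro sum.cong) auto
    then show ?thesis using supermartingale_maker[OF 2 pos] M False by simp
  qed
qed

text \<open>Averages over the picks left in a round, one at a time. In the application
  \<open>g\<close> is the failure probability of the rest of the game as a function of Maker's graph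
  after the round, and \<open>M0\<close> is that graph before the round.\<close>

lemma one_round_bound:
  fixes g :: "edge set \<Rightarrow> real"
  assumes sup: "supermartingale n m 0 L \<Psi>" and m: "0 < m" and board: "2 * L + 1 < card (K_edges n)"
    and bad: "\<And>j B M. position n m B M j \<Longrightarrow> card M = L \<Longrightarrow> bad M \<le> \<Psi> j B M"
    and anti: "\<And>M M'. M \<subseteq> M' \<Longrightarrow> M' \<subseteq> K_edges n \<Longrightarrow> g M' \<le> bad M"
    and g: "\<And>M. M0 \<subseteq> M \<Longrightarrow> position n m B M 0 \<Longrightarrow> card M \<le> L \<Longrightarrow> g M \<le> \<Psi> 0 B M"
  shows "M0 \<subseteq> M \<Longrightarrow> position n m B M j \<Longrightarrow> card M \<le> L \<Longrightarrow>
    measure_pmf.expectation (maker_move j (K_edges n - (B \<union> M))) (\<lambda>X. g (M \<union> X)) \<le> \<Psi> j B M"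
proof (induction j arbitrary: M)
  case 0
  then show ?case using g by (simp add: maker_move_0 finite_K_edges)
next
  case (Suc j)
  let ?F = "K_edges n - (B \<union> M)"
  have fin: "finite ?F" by (simp add: finite_K_edges)
  have finm: "finite (set_pmf (maker_move i ?F))" for i
    using set_pmf_maker_move[OF fin] fin by simp
  show ?case
  proof (cases "card M = L")
    \<comment> \<open>The target \<open>L\<close> is reached, possibly in mid-round: by
      \<open>anti\<close> the remaining picks cannot push \<open>g\<close> above
      \<open>bad M\<close>.\<close>
    case True
    have "measure_pmf.expectation (maker_move (Suc j) ?F) (\<lambda>X. g (M \<union> X))
        \<le> measure_pmf.expectation (maker_move (Suc j) ?F) (\<lambda>X. bad M)"
    proof (rule integral_mono_AE)
      show "AE X in measure_pmf (maker_move (Suc j) ?F). g (M \<union> X) \<le> bad M"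
        using set_pmf_maker_move[OF fin, of "Suc j"] Suc.prems(2)
        by (auto simp: AE_measure_pmf_iff position_def intro!: anti)
    qed (auto intro: integrable_measure_pmf_finite finm)
    also have "\<dots> = bad M" by simp
    finally show ?thesis using bad[OF Suc.prems(2) True] by linarith
  next
    case False
    then have lt: "card M < L" using Suc.prems(3) by simp
    \<comment> \<open>Fewer than \<open>2 * L + 1\<close> edges are claimed, so the board is not
      empty and the factor \<open>card ?F\<close> can be cancelled at the end.\<close>
    have "card (B \<union> M) \<le> card B + card M" by (rule card_Un_le)
    also have "\<dots> < card (K_edges n)" using position_card(1)[OF Suc.prems(2) m] lt board by simp
    finally have ne: "?F \<noteq> {}" using finite_position[OF Suc.prems(2)]
      by (metis Diff_eq_empty_iff card_mono finite_UnI not_less)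
    have "real (card ?F) * measure_pmf.expectation (maker_move (Suc j) ?F) (\<lambda>X. g (M \<union> X))
       = (\<Sum>e\<in>?F. measure_pmf.expectation (maker_move j (?F - {e})) (\<lambda>X. g (M \<union> insert e X)))"
      by (rule expectation_maker_move_Suc[OF fin ne])
    also have "\<dots> \<le> (\<Sum>e\<in>?F. \<Psi> j B (insert e M))"
    proof (rule sum_mono)
      fix e assume e: "e \<in> ?F"
      have "?F - {e} = K_edges n - (B \<union> insert e M)" "\<And>X. M \<union> insert e X = insert e M \<union> X" by auto
      then show "measure_pmf.expectation (maker_move j (?F - {e})) (\<lambda>X. g (M \<union> insert e X)) \<le> \<Psi> j B (insert e M)"
        using Suc.IH[OF subset_insertI2[OF Suc.prems(1)] position_pick(1)[OF Suc.prems(2) e]] position_pick(2)[OF Suc.prems(2) e] lt by simp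
    qed
    also have "\<dots> \<le> real (card ?F) * \<Psi> (Suc j) B M"
      by (rule supermartingale_maker[OF sup Suc.prems(2) _ lt]) simp
    finally show ?thesis using ne fin by (simp add: card_gt_0_iff)
  qed
qed

text \<open>\<open>play_rounds\<close> adds the last round; induction on the rounds still to come
  wants the first one split off.\<close>

primrec play_from :: "nat \<Rightarrow> nat \<Rightarrow> strategy \<Rightarrow> nat \<Rightarrow> history \<Rightarrow> history pmf" where
  "play_from n m \<sigma> 0 h = return_pmf h"
| "play_from n m \<sigma> (Suc k) h = bind_pmf (play_round n m \<sigma> h) (play_from n m \<sigma> k)"

lemma bind_play_rounds: "bind_pmf (play_rounds n m \<sigma> k) (play_from n m \<sigma> l) = play_rounds n m \<sigma> (k + l)"
proof (induction l arbitrary: k)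
  case 0
  then show ?case by (simp add: bind_return_pmf')
next
  case (Suc l)
  have *: "play_from n m \<sigma> (Suc l) = (\<lambda>h. bind_pmf (play_round n m \<sigma> h) (play_from n m \<sigma> l))"
    by (rule ext) simp
  have "bind_pmf (play_rounds n m \<sigma> k) (play_from n m \<sigma> (Suc l)) = bind_pmf (play_rounds n m \<sigma> (Suc k)) (play_from n m \<sigma> l)"
    unfolding * by (simp add: bind_assoc_pmf)
  then show ?case using Suc[of "Suc k"] by (simp only: add_Suc add_Suc_right)
qed

lemma random_maker_game_play_from: "random_maker_game n m \<sigma> = play_from n m \<sigma> (card (K_edges n)) []"
  using bind_play_rounds[of n m \<sigma> 0 "card (K_edges n)"] by (simp add: random_maker_game_def bind_return_pmf)

lemma play_from_mono:
  assumes "h' \<in> set_pmf (play_from n m \<sigma> k h)"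
  shows "maker_graph h \<subseteq> maker_graph h'"
  using assms
proof (induction k arbitrary: h)
  case (Suc k)
  then obtain h1 where h1: "h1 \<in> set_pmf (play_round n m \<sigma> h)" "h' \<in> set_pmf (play_from n m \<sigma> k h1)" by auto
  have "maker_graph h \<subseteq> maker_graph h1"
    using h1(1) by (auto simp: play_round_def maker_graph_def split: if_splits)
  then show ?case using Suc.IH[OF h1(2)] by blast
qed simp

lemma prob_bind_pmf:
  "measure_pmf.prob (bind_pmf p q) X = measure_pmf.expectation p (\<lambda>x. measure_pmf.prob (q x) X)"
proof -
  have "ennreal (measure_pmf.prob (bind_pmf p q) X) = (\<integral>\<^sup>+x. ennreal (measure_pmf.prob (q x) X) \<partial>p)"
    by (simp add: measure_pmf.emeasure_eq_measure[symmetric])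
  also have "\<dots> = ennreal (measure_pmf.expectation p (\<lambda>x. measure_pmf.prob (q x) X))"
    by (intro nn_integral_eq_integral measure_pmf.integrable_const_bound[where B = 1]) auto
  finally show ?thesis by (simp add: integral_nonneg_AE)
qed

text \<open>Induction on the number \<open>k\<close> of remaining rounds. The hypothesis
  \<open>L \<le> k + card (breaker_graph h)\<close> says that these rounds suffice for
  \<open>L\<close> Maker edges, since Maker owns at least one edge per completed round.\<close>

lemma play_from_bound:
  assumes sup: "supermartingale n m 0 L \<Psi>" and m: "0 < m" and board: "2 * L + 1 < card (K_edges n)"
    and strat: "breaker_strategy n \<sigma>"
    and anti: "\<And>M M'. M \<subseteq> M' \<Longrightarrow> bad M' \<Longrightarrow> bad M"
    and bad: "\<And>j B M. position n m B M j \<Longrightarrow> card M = L \<Longrightarrow> of_bool (bad M) \<le> \<Psi> j B M"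
  shows "position n m (breaker_graph h) (maker_graph h) 0 \<Longrightarrow> card (maker_graph h) \<le> L \<Longrightarrow>
    L \<le> k + card (breaker_graph h) \<Longrightarrow>
    measure_pmf.prob (play_from n m \<sigma> k h) {h. bad (maker_graph h)} \<le> \<Psi> 0 (breaker_graph h) (maker_graph h)"
proof (induction k arbitrary: h)
  case 0
  have "card (breaker_graph h) \<le> m * card (breaker_graph h)" using m by simp
  moreover have "card (maker_graph h) = m * card (breaker_graph h)" using 0(1) by (simp add: position_def)
  ultimately have "card (maker_graph h) = L" using 0(2,3) by linarith
  then show ?case using bad[OF 0(1)] by (simp add: indicator_def)
next
  case (Suc k)
  let ?B = "breaker_graph h" and ?M = "maker_graph h" and ?P = "\<lambda>k h. measure_pmf.prob (play_from n m \<sigma> k h) {h. bad (maker_graph h)}"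
  \<comment> \<open>Maker's graph only grows, so a bad final graph makes every earlier graph
    bad.\<close>
  have anti': "?P k h \<le> of_bool (bad M)" if "M \<subseteq> maker_graph h" for k h M
  proof (cases "bad M")
    case False
    have "set_pmf (play_from n m \<sigma> k h) \<inter> {h. bad (maker_graph h)} = {}"
      using play_from_mono[of _ n m \<sigma> k h] anti False that by blast
    then have "?P k h = 0" by (simp add: measure_pmf_zero_iff)
    then show ?thesis by simp
  qed simp
  show ?case
  proof (cases "card ?M = L")
    case True
    then show ?thesis using bad[OF Suc.prems(1) True] anti'[OF subset_refl, of "Suc k" h] by linarith
  next
    case False
    then have lt: "card ?M < L" using Suc.prems(2) by simp
    have "card (?B \<union> ?M) \<le> card ?B + card ?M" by (rule card_Un_le)
    also have "\<dots> < card (K_edges n)" using position_card(1)[OF Suc.prems(1) m] lt board by simp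
    finally have ne: "unclaimed n h \<noteq> {}" using finite_position[OF Suc.prems(1)]
      unfolding unclaimed_def by (metis Diff_eq_empty_iff card_mono finite_UnI not_less)
    define e where "e = \<sigma> h"
    have e: "e \<in> K_edges n - (?B \<union> ?M)" using strat ne by (auto simp: e_def breaker_strategy_def unclaimed_def)
    have F: "unclaimed n h - {e} = K_edges n - (insert e ?B \<union> ?M)" by (auto simp: unclaimed_def)
    have pos': "position n m (insert e ?B) ?M m"
      using Suc.prems(1) e finite_position[OF Suc.prems(1)] by (auto simp: position_def)
    \<comment> \<open>Expresses the future as a function of Maker's whole graph. The edges of the
      current round are recovered as \<open>M - ?M\<close>, which is correct because they are
      disjoint from \<open>?M\<close>.\<close>
    define g where "g = (\<lambda>M. ?P k (h @ [(e, M - ?M)]))"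
    have gr: "breaker_graph (h @ [(e, X)]) = insert e ?B" "maker_graph (h @ [(e, X)]) = ?M \<union> X" for X
      by (auto simp: breaker_graph_def maker_graph_def)
    have cB: "card (insert e ?B) = Suc (card ?B)" using e finite_position[OF Suc.prems(1)] by simp
    have "?P (Suc k) h = measure_pmf.expectation (maker_move m (unclaimed n h - {e})) (\<lambda>X. ?P k (h @ [(e, X)]))"
      using ne by (simp add: play_round_def e_def bind_map_pmf prob_bind_pmf)
    also have "\<dots> = measure_pmf.expectation (maker_move m (unclaimed n h - {e})) (\<lambda>X. g (?M \<union> X))"
    proof (rule integral_cong_AE)
      have "finite (unclaimed n h - {e})" by (simp add: finite_unclaimed)
      from set_pmf_maker_move[OF this]
      show "AE X in measure_pmf (maker_move m (unclaimed n h - {e})). ?P k (h @ [(e, X)]) = g (?M \<union> X)"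
        by (auto simp: AE_measure_pmf_iff g_def unclaimed_def intro!: arg_cong2[where f = measure_pmf.prob] arg_cong[where f = "play_from n m \<sigma> k"])
    qed simp_all
    also have "\<dots> \<le> \<Psi> m (insert e ?B) ?M"
      unfolding F
    proof (rule one_round_bound[OF sup m board, where bad = "\<lambda>M. of_bool (bad M)" and M0 = ?M])
      fix M M' :: "edge set" assume "M \<subseteq> M'"
      then show "g M' \<le> of_bool (bad M)" unfolding g_def by (intro anti') (auto simp: gr)
    next
      fix M assume M: "?M \<subseteq> M" "position n m (insert e ?B) M 0" "card M \<le> L"
      then have "?M \<union> (M - ?M) = M" by auto
      then show "g M \<le> \<Psi> 0 (insert e ?B) M"
        using Suc.IH[of "h @ [(e, M - ?M)]"] M Suc.prems(3) unfolding g_def gr cB by simp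
    qed (use bad pos' lt in auto)
    also have "\<dots> \<le> \<Psi> 0 ?B ?M" using supermartingale_breaker[OF sup Suc.prems(1) _ lt e] by simp
    finally show ?thesis .
  qed
qed

lemma random_maker_game_bound:
  assumes sup: "supermartingale n m 0 L \<Psi>" and m: "0 < m" and board: "2 * L + 1 < card (K_edges n)"
    and strat: "breaker_strategy n \<sigma>"
    and anti: "\<And>M M'. M \<subseteq> M' \<Longrightarrow> bad M' \<Longrightarrow> bad M"
    and bad: "\<And>j B M. position n m B M j \<Longrightarrow> card M = L \<Longrightarrow> of_bool (bad M) \<le> \<Psi> j B M"
  shows "measure_pmf.prob (random_maker_game n m \<sigma>) {h. bad (maker_graph h)} \<le> \<Psi> 0 {} {}"
proof -
  have "breaker_graph [] = {}" "maker_graph [] = {}" by (auto simp: breaker_graph_def maker_graph_def)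
  then show ?thesis
    using play_from_bound[where bad = bad and h = "[]" and k = "card (K_edges n)", OF sup m board strat anti bad] board
    by (simp add: random_maker_game_play_from position_def)
qed

section \<open>Minimum degree\<close>

lemma card_K_edges: "real (card (K_edges n)) = real n * (real n - 1) / 2"
proof -
  have "card (K_edges n) = n choose 2" by (simp add: K_edges_def)
  moreover have "real (n choose 2) = real n * (real n - 1) / 2"
    by (induction n) (simp_all add: numeral_2_eq_2 field_simps)
  ultimately show ?thesis by simp
qed

lemma card_unclaimed_le: "real (card (K_edges n - X)) \<le> real n ^ 2 / 2"
proof -
  have "card (K_edges n - X) \<le> card (K_edges n)" by (simp add: card_mono finite_K_edges)
  then have "real (card (K_edges n - X)) \<le> real n * (real n - 1) / 2" using card_K_edges[of n] by linarith
  also have "\<dots> \<le> real n ^ 2 / 2" by (simp add: power2_eq_square algebra_simps)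
  finally show ?thesis .
qed

text \<open>A pick lies in \<open>A\<close> with probability at least \<open>p\<close> and then
  scales the bound \<open>y\<close> by \<open>c\<close>, so the mean factor is at most
  \<open>(1 - p) + c * p\<close>.\<close>

lemma sum_pick_decay:
  fixes f :: "'a \<Rightarrow> real"
  assumes F: "finite F" "A \<subseteq> F" and p: "p * real (card F) \<le> real (card A)" and c: "c \<le> 1" and y: "0 \<le> y"
    and hit: "\<And>e. e \<in> A \<Longrightarrow> f e \<le> c * y" and miss: "\<And>e. e \<in> F - A \<Longrightarrow> f e \<le> y"
  shows "(\<Sum>e\<in>F. f e) \<le> real (card F) * ((1 - (1 - c) * p) * y)"
proof -
  have fA: "finite A" using F finite_subset by blast
  have cd: "real (card (F - A)) = real (card F) - real (card A)"
    using card_Diff_subset[OF fA F(2)] card_mono[OF F] by simp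
  have "(\<Sum>e\<in>F. f e) = (\<Sum>e\<in>F - A. f e) + (\<Sum>e\<in>A. f e)" by (rule sum.subset_diff[OF F(2,1)])
  also have "\<dots> \<le> real (card (F - A)) * y + real (card A) * (c * y)"
    using sum_bounded_above[of "F - A" f y] sum_bounded_above[of A f "c * y"] hit miss by (simp add: add_mono)
  also have "\<dots> = real (card F) * y - ((1 - c) * real (card A)) * y" unfolding cd by (simp add: algebra_simps)
  also have "\<dots> \<le> real (card F) * y - ((1 - c) * (p * real (card F))) * y"
    using p c y by (intro diff_left_mono mult_right_mono mult_left_mono) auto
  also have "\<dots> = real (card F) * ((1 - (1 - c) * p) * y)" by (simp add: algebra_simps)
  finally show ?thesis .
qed

definition deg :: "edge set \<Rightarrow> nat \<Rightarrow> nat" where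
  "deg M v = card {e \<in> M. v \<in> e}"

lemma deg_insert: "finite M \<Longrightarrow> e \<notin> M \<Longrightarrow> deg (insert e M) v = deg M v + of_bool (v \<in> e)"
proof -
  assume "finite M" "e \<notin> M"
  moreover have "{x \<in> insert e M. v \<in> x} = (if v \<in> e then insert e {x \<in> M. v \<in> x} else {x \<in> M. v \<in> x})" by auto
  ultimately show ?thesis by (simp add: deg_def)
qed

lemma deg_K_edges:
  assumes "v < n"
  shows "deg (K_edges n) v = n - 1"
proof -
  have "{e \<in> K_edges n. v \<in> e} = (\<lambda>w. {v, w}) ` ({..<n} - {v})" (is "?L = ?R")
  proof
    show "?R \<subseteq> ?L" using assms by (auto simp: K_edges_iff)
    show "?L \<subseteq> ?R"
    proof
      fix e assume e: "e \<in> ?L"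
      then obtain a b where ab: "e = {a, b}" by (auto simp: K_edges_def nsets_def card_2_iff)
      then have "a < n" "b < n" "a \<noteq> b" "v = a \<or> v = b" using e by (auto simp: K_edges_iff)
      then show "e \<in> ?R" unfolding ab by auto
    qed
  qed
  moreover have "inj_on (\<lambda>w. {v, w}) ({..<n} - {v})" by (auto simp: inj_on_def doubleton_eq_iff)
  ultimately show ?thesis using assms by (simp add: deg_def card_image)
qed

lemma unclaimed_deg:
  assumes "v < n" "finite B" "finite M"
  shows "n - 1 \<le> card {e \<in> K_edges n - (B \<union> M). v \<in> e} + deg B v + deg M v"
proof -
  have "{e \<in> K_edges n. v \<in> e} \<subseteq> {e \<in> K_edges n - (B \<union> M). v \<in> e} \<union> {e \<in> B. v \<in> e} \<union> {e \<in> M. v \<in> e}" by auto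
  then have "deg (K_edges n) v \<le> card ({e \<in> K_edges n - (B \<union> M). v \<in> e} \<union> {e \<in> B. v \<in> e} \<union> {e \<in> M. v \<in> e})"
    unfolding deg_def using assms(2,3) finite_K_edges by (intro card_mono) auto
  also have "\<dots> \<le> card {e \<in> K_edges n - (B \<union> M). v \<in> e} + deg B v + deg M v"
    unfolding deg_def by (intro order_trans[OF card_Un_le] add_mono card_Un_le) auto
  finally show ?thesis using deg_K_edges[OF assms(1)] by simp
qed

text \<open>The threshold 12 is the minimum degree used in \<open>expanderI\<close>. Each Maker edge
  halves the weight until the vertex is safe and weighs 0.\<close>

definition low_weight :: "nat \<Rightarrow> real" where
  "low_weight d = (if d < 12 then (1/2) ^ d else 0)"

lemma low_weight_bounds: "0 \<le> low_weight d" "low_weight d \<le> 1" "low_weight (Suc d) \<le> 1/2 * low_weight d"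
  by (auto simp: low_weight_def power_le_one)

lemma low_weight_ge: "d < 12 \<Longrightarrow> (1/2) ^ 11 \<le> low_weight d"
  using power_decreasing[of d 11 "1/2::real"] by (simp add: low_weight_def)

text \<open>Beyond Breaker degree \<open>n div 2\<close> a vertex is written off unless it is safe.
  Below, \<open>G\<close> will be chosen so that an unsafe vertex weighs at least 1 when it reaches
  that degree. The factor \<open>\<rho> ^ j\<close> credits in advance the mean decrease through the
  picks left in the round. The last summand covers vertices that Breaker leaves alone: at
  \<open>card M = L\<close> it alone gives an unsafe vertex weight at least 1.\<close>

definition degree_potential :: "nat \<Rightarrow> real \<Rightarrow> real \<Rightarrow> real \<Rightarrow> nat \<Rightarrow> nat \<Rightarrow> nat \<Rightarrow> edge set \<Rightarrow> edge set \<Rightarrow> real" where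
  "degree_potential n \<rho> \<alpha> G L v j B M =
     (if n div 2 < deg B v then of_bool (deg M v < 12)
      else low_weight (deg M v) * (\<rho> ^ j * ((exp (\<alpha> * real (deg B v)) - 1) / G) + 2 ^ 11 * \<rho> ^ (L - card M)))"

lemma degree_potential_nonneg:
  assumes "0 \<le> \<rho>" "0 \<le> \<alpha>" "0 < G"
  shows "0 \<le> degree_potential n \<rho> \<alpha> G L v j B M"
  using assms low_weight_bounds(1)[of "deg M v"] by (auto simp: degree_potential_def)

lemma degree_potential_final:
  assumes "0 \<le> \<rho>" "0 \<le> \<alpha>" "0 < G" "card M = L" "deg M v < 12"
  shows "1 \<le> degree_potential n \<rho> \<alpha> G L v j B M"
proof (cases "n div 2 < deg B v")
  case False
  have "(1::real) = (1/2) ^ 11 * (0 + 2 ^ 11)" by (simp add: power_divide)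
  also have "\<dots> \<le> low_weight (deg M v) * (\<rho> ^ j * ((exp (\<alpha> * real (deg B v)) - 1) / G) + 2 ^ 11 * \<rho> ^ (L - card M))"
    using assms low_weight_ge[OF assms(5)] low_weight_bounds(1)[of "deg M v"] by (intro mult_mono add_mono) auto
  finally show ?thesis using False by (simp add: degree_potential_def)
qed (use assms in \<open>simp add: degree_potential_def\<close>)

text \<open>The \<open>m\<close> picks credited by \<open>\<rho> ^ m\<close> pay for the factor
  \<open>exp \<alpha>\<close> by which the exponential grows. What stays unpaid is an additive
  \<open>exp \<alpha> - 1\<close>, caused by the subtracted 1, at the ends of
  \<open>e\<close>.\<close>

lemma degree_potential_breaker:
  assumes \<rho>: "0 \<le> \<rho>" "\<rho> \<le> 1" and \<alpha>: "0 \<le> \<alpha>" "exp \<alpha> * \<rho> ^ m \<le> 1"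
    and G: "G = (1/2) ^ 11 * (exp (\<alpha> * real (n div 2)) - 1)" "0 < G"
    and B: "finite B" "e \<notin> B"
  shows "degree_potential n \<rho> \<alpha> G L v m (insert e B) M
    \<le> degree_potential n \<rho> \<alpha> G L v 0 B M + of_bool (v \<in> e) * ((exp \<alpha> - 1) / G)"
proof -
  let ?h = "low_weight (deg M v)" and ?b = "deg B v" and ?z = "2 ^ 11 * \<rho> ^ (L - card M)"
  note h = low_weight_bounds(1,2)[of "deg M v"]
  have r: "0 \<le> \<rho> ^ m" "\<rho> ^ m \<le> 1" using \<rho> by (auto simp: power_le_one)
  have a1: "1 \<le> exp \<alpha>" using \<alpha> by simp
  have E1: "1 \<le> exp (\<alpha> * real b)" for b using \<alpha> by simp
  show ?thesis
  proof (cases "v \<in> e")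
    case False
    then have d: "deg (insert e B) v = ?b" using deg_insert[OF B] by simp
    have "?h * (\<rho> ^ m * ((exp (\<alpha> * real ?b) - 1) / G) + ?z) \<le> ?h * (1 * ((exp (\<alpha> * real ?b) - 1) / G) + ?z)"
      using h r E1[of ?b] G(2) by (intro mult_left_mono add_mono mult_right_mono) auto
    then show ?thesis using False by (simp add: degree_potential_def d)
  next
    case True
    then have d: "deg (insert e B) v = ?b + 1" using deg_insert[OF B] by simp
    have nn: "0 \<le> (exp \<alpha> - 1) / G" using a1 G(2) by simp
    consider "n div 2 < ?b" | "?b = n div 2" | "?b < n div 2" by linarith
    then show ?thesis
    proof cases
      case 1
      then show ?thesis using True nn by (simp add: degree_potential_def d)
    next
      case 2
      \<comment> \<open>The vertex is just being written off; by the choice of \<open>G\<close> it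
        already weighs at least 1 if it is unsafe.\<close>
      have "of_bool (deg M v < 12) \<le> ?h * ((exp (\<alpha> * real ?b) - 1) / G + ?z)"
      proof (cases "deg M v < 12")
        case True
        have "(exp (\<alpha> * real ?b) - 1) / G = 2 ^ 11" using G 2 by (simp add: field_simps)
        then have "(1::real) = (1/2) ^ 11 * ((exp (\<alpha> * real ?b) - 1) / G + 0)" by (simp add: power_divide)
        also have "\<dots> \<le> ?h * ((exp (\<alpha> * real ?b) - 1) / G + ?z)"
          using low_weight_ge[OF True] h \<rho> E1[of ?b] G(2) by (intro mult_mono add_mono) auto
        finally show ?thesis using True by simp
      qed (use h \<rho> E1[of ?b] G(2) in simp)
      then show ?thesis using 2 True nn by (simp add: degree_potential_def d)
    next
      case 3
      \<comment> \<open>Separates the part whose growth is paid for by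
        \<open>exp \<alpha> * \<rho> ^ m \<le> 1\<close> from the additive loss.\<close>
      have "\<rho> ^ m * (exp \<alpha> * exp (\<alpha> * real ?b) - 1) = (exp \<alpha> * \<rho> ^ m) * (exp (\<alpha> * real ?b) - 1) + \<rho> ^ m * (exp \<alpha> - 1)"
        by (simp add: algebra_simps)
      also have "\<dots> \<le> 1 * (exp (\<alpha> * real ?b) - 1) + 1 * (exp \<alpha> - 1)"
        using \<alpha>(2) r a1 E1[of ?b] by (intro add_mono mult_right_mono) auto
      finally have "\<rho> ^ m * (exp \<alpha> * exp (\<alpha> * real ?b) - 1) / G \<le> ((exp (\<alpha> * real ?b) - 1) + (exp \<alpha> - 1)) / G"
        using G(2) by (intro divide_right_mono) auto
      then have "\<rho> ^ m * ((exp (\<alpha> * real (?b + 1)) - 1) / G) \<le> (exp (\<alpha> * real ?b) - 1) / G + (exp \<alpha> - 1) / G"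
        by (simp add: exp_add distrib_left mult.commute add_divide_distrib[symmetric])
      then have "?h * (\<rho> ^ m * ((exp (\<alpha> * real (?b + 1)) - 1) / G) + ?z)
          \<le> ?h * (((exp (\<alpha> * real ?b) - 1) / G + (exp \<alpha> - 1) / G) + ?z)"
        using h by (intro mult_left_mono add_mono) auto
      also have "\<dots> = ?h * ((exp (\<alpha> * real ?b) - 1) / G + ?z) + ?h * ((exp \<alpha> - 1) / G)"
        by (simp add: algebra_simps)
      also have "\<dots> \<le> ?h * ((exp (\<alpha> * real ?b) - 1) / G + ?z) + 1 * ((exp \<alpha> - 1) / G)"
        using h nn by (intro add_left_mono mult_right_mono) auto
      finally show ?thesis using 3 True by (simp add: degree_potential_def d)
    qed
  qed
qed

text \<open>An unsafe vertex of Breaker degree at most n/2 has at least n/3 unclaimed edges, out of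
  at most n^2/2 on the board. A pick hits it with probability at least 2/(3n) and halves its weight;
  the mean factor \<open>\<rho>\<close> is exactly what both powers of \<rho> lose with one
  pick.\<close>

lemma degree_potential_maker:
  assumes n: "72 \<le> n" and v: "v < n" and \<rho>: "\<rho> = 1 - 1 / (3 * real n)" and \<alpha>: "0 \<le> \<alpha>" and G: "0 < G"
    and pos: "position n m B M (Suc j)" "card M < L"
  shows "(\<Sum>e\<in>K_edges n - (B \<union> M). degree_potential n \<rho> \<alpha> G L v j B (insert e M))
     \<le> real (card (K_edges n - (B \<union> M))) * degree_potential n \<rho> \<alpha> G L v (Suc j) B M"
proof -
  let ?F = "K_edges n - (B \<union> M)" and ?b = "deg B v" and ?d = "deg M v"
  have fin: "finite B" "finite M" "finite ?F" using finite_position[OF pos(1)] finite_K_edges by auto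
  have d': "deg (insert e M) v = ?d + of_bool (v \<in> e)" "card (insert e M) = Suc (card M)" if "e \<in> ?F" for e
    using that deg_insert[OF fin(2)] fin by auto
  show ?thesis
  proof (cases "n div 2 < ?b")
    case True
    have "(\<Sum>e\<in>?F. degree_potential n \<rho> \<alpha> G L v j B (insert e M)) \<le> (\<Sum>e\<in>?F. of_bool (?d < 12))"
      using True d' by (intro sum_mono) (auto simp: degree_potential_def)
    then show ?thesis using True by (simp add: degree_potential_def)
  next
    case b: False
    let ?w = "(exp (\<alpha> * real ?b) - 1) / G"
    define C where "C = \<rho> ^ j * ?w + 2 ^ 11 * \<rho> ^ (L - Suc (card M))"
    have \<rho>0: "0 \<le> \<rho>" using n unfolding \<rho> by (simp add: field_simps)
    have C0: "0 \<le> C" unfolding C_def using \<rho>0 \<alpha> G by (auto intro!: add_nonneg_nonneg mult_nonneg_nonneg)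
    have val: "degree_potential n \<rho> \<alpha> G L v j B (insert e M) = low_weight (?d + of_bool (v \<in> e)) * C" if "e \<in> ?F" for e
      using b d'[OF that] by (simp add: degree_potential_def C_def)
    have "L - card M = Suc (L - Suc (card M))" using pos(2) by simp
    then have cur: "degree_potential n \<rho> \<alpha> G L v (Suc j) B M = \<rho> * (low_weight ?d * C)"
      using b by (simp add: degree_potential_def C_def algebra_simps)
    show ?thesis
    proof (cases "?d < 12")
      case True
      let ?A = "{e \<in> ?F. v \<in> e}"
      have "n - 1 \<le> card ?A + ?b + ?d" by (rule unclaimed_deg[OF v fin(1,2)])
      \<comment> \<open>\<open>n - 1 - n/2 - 11\<close> is at least \<open>n/3\<close> from
        \<open>n = 72\<close> on.\<close>
      then have "real n / 3 \<le> real (card ?A)" using b True n by linarith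
      moreover have "2 / (3 * real n) * real (card ?F) \<le> 2 / (3 * real n) * (real n ^ 2 / 2)"
        by (intro mult_left_mono card_unclaimed_le) auto
      moreover have "2 / (3 * real n) * (real n ^ 2 / 2) = real n / 3" using n by (simp add: power2_eq_square)
      ultimately have p: "2 / (3 * real n) * real (card ?F) \<le> real (card ?A)" by linarith
      have "(\<Sum>e\<in>?F. degree_potential n \<rho> \<alpha> G L v j B (insert e M))
         \<le> real (card ?F) * ((1 - (1 - 1/2) * (2 / (3 * real n))) * (low_weight ?d * C))"
      proof (rule sum_pick_decay[OF fin(3) _ p])
        fix e assume "e \<in> ?A"
        then show "degree_potential n \<rho> \<alpha> G L v j B (insert e M) \<le> 1/2 * (low_weight ?d * C)"
          using val[of e] mult_right_mono[OF low_weight_bounds(3)[of ?d] C0] by simp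
      next
        fix e assume "e \<in> ?F - ?A"
        then have "e \<in> ?F" "v \<notin> e" by auto
        then show "degree_potential n \<rho> \<alpha> G L v j B (insert e M) \<le> low_weight ?d * C"
          using val[of e] by simp
      qed (use C0 low_weight_bounds(1) in auto)
      also have "(1 - (1 - 1/2) * (2 / (3 * real n))) = \<rho>" by (simp add: \<rho>)
      finally show ?thesis by (simp add: cur)
    next
      case False
      then have "(\<Sum>e\<in>?F. degree_potential n \<rho> \<alpha> G L v j B (insert e M)) = 0"
        using val by (intro sum.neutral) (auto simp: low_weight_def)
      then show ?thesis using False by (simp add: cur low_weight_def)
    qed
  qed
qed

text \<open>The second summand is an account from which each Breaker edge draws the unpaid amount
  for its two ends. \<open>R\<close> will later bound the number of Breaker edges, so that the
  account is never overdrawn.\<close>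

lemma degree_supermartingale:
  assumes n: "72 \<le> n" and \<rho>: "\<rho> = 1 - 1 / (3 * real n)" and \<alpha>: "0 \<le> \<alpha>" "exp \<alpha> * \<rho> ^ m \<le> 1"
    and G: "G = (1/2) ^ 11 * (exp (\<alpha> * real (n div 2)) - 1)" "0 < G"
  shows "supermartingale n m 0 L (\<lambda>j B M. (\<Sum>v<n. degree_potential n \<rho> \<alpha> G L v j B M) + (R - real (card B)) * (2 * (exp \<alpha> - 1) / G))"
proof (rule supermartingaleI)
  fix B M e assume pos: "position n m B M 0" and e: "e \<in> K_edges n - (B \<union> M)"
  have \<rho>01: "0 \<le> \<rho>" "\<rho> \<le> 1" using n unfolding \<rho> by (simp_all add: field_simps)
  have fB: "finite B" using finite_position[OF pos] by simp
  have "{v \<in> {..<n}. v \<in> e} = e" "card e = 2" using e by (auto simp: K_edges_def nsets_def)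
  then have "(\<Sum>v<n. of_bool (v \<in> e) :: real) = 2" by (simp add: Int_def)
  then have "(\<Sum>v<n. of_bool (v \<in> e) * ((exp \<alpha> - 1) / G)) = 2 * (exp \<alpha> - 1) / G"
    unfolding sum_distrib_right[symmetric] by simp
  moreover have "(\<Sum>v<n. degree_potential n \<rho> \<alpha> G L v m (insert e B) M)
      \<le> (\<Sum>v<n. degree_potential n \<rho> \<alpha> G L v 0 B M + of_bool (v \<in> e) * ((exp \<alpha> - 1) / G))"
    using e by (intro sum_mono degree_potential_breaker[OF \<rho>01 \<alpha> G fB]) auto
  moreover have "real (card (insert e B)) = real (card B) + 1" using fB e by simp
  ultimately show "(\<Sum>v<n. degree_potential n \<rho> \<alpha> G L v m (insert e B) M) + (R - real (card (insert e B))) * (2 * (exp \<alpha> - 1) / G)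
    \<le> (\<Sum>v<n. degree_potential n \<rho> \<alpha> G L v 0 B M) + (R - real (card B)) * (2 * (exp \<alpha> - 1) / G)"
    by (simp only: sum.distrib) (simp only: algebra_simps)
next
  fix B M j assume pos: "position n m B M (Suc j)" "card M < L"
  let ?F = "K_edges n - (B \<union> M)"
  have "(\<Sum>e\<in>?F. \<Sum>v<n. degree_potential n \<rho> \<alpha> G L v j B (insert e M))
      = (\<Sum>v<n. \<Sum>e\<in>?F. degree_potential n \<rho> \<alpha> G L v j B (insert e M))" by (rule sum.swap)
  also have "\<dots> \<le> (\<Sum>v<n. real (card ?F) * degree_potential n \<rho> \<alpha> G L v (Suc j) B M)"
    using pos by (intro sum_mono degree_potential_maker[OF n _ \<rho> \<alpha>(1) G(2)]) auto
  finally show "(\<Sum>e\<in>?F. (\<Sum>v<n. degree_potential n \<rho> \<alpha> G L v j B (insert e M)) + (R - real (card B)) * (2 * (exp \<alpha> - 1) / G))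
    \<le> real (card ?F) * ((\<Sum>v<n. degree_potential n \<rho> \<alpha> G L v (Suc j) B M) + (R - real (card B)) * (2 * (exp \<alpha> - 1) / G))"
    by (simp add: sum.distrib distrib_left sum_distrib_left)
qed

section \<open>Cuts, dense sets and boosters\<close>

definition no_edge_between :: "edge set \<Rightarrow> nat set \<Rightarrow> nat set \<Rightarrow> bool" where
  "no_edge_between M S W \<longleftrightarrow> (\<forall>v\<in>S. \<forall>w\<in>W. {v, w} \<notin> M)"

text \<open>At least n/4 vertices lie outside \<open>S\<close> and \<open>T\<close>, so at least
  \<open>card S * n / 4\<close> pairs lead to them from \<open>S\<close>. Breaker owns at most
  \<open>L\<close>, half of that number. As long as Maker has none, the others are unclaimed, and a
  pick takes one with probability at least (card S * n / 8) / (n^2 / 2).\<close>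

lemma cut_supermartingale:
  assumes S: "S \<subseteq> {..<n}" "4 * card S \<le> n" and T: "T \<subseteq> {..<n}" "card T = 2 * card S"
    and L: "8 * L \<le> card S * n" and m: "0 < m" and n: "0 < n"
  shows "supermartingale n m 0 L
    (\<lambda>j B M. of_bool (no_edge_between M S ({..<n} - S - T)) * (1 - real (card S) / (4 * real n)) ^ (L - card M))"
proof (rule supermartingaleI)
  fix B M j assume pos: "position n m B M (Suc j)" and lt: "card M < L"
  let ?F = "K_edges n - (B \<union> M)" and ?W = "{..<n} - S - T" and ?p = "real (card S) / (4 * real n)"
  let ?f = "\<lambda>e. of_bool (no_edge_between (insert e M) S ?W) * (1 - ?p) ^ (L - card (insert e M))"
  have fin: "finite B" "finite M" "finite ?F" using finite_position[OF pos] finite_K_edges by auto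
  have fST: "finite S" "finite T" using S T finite_subset by blast+
  have p01: "0 \<le> 1 - ?p" using S(2) n by (simp add: field_simps)
  show "(\<Sum>e\<in>?F. ?f e) \<le> real (card ?F) * (of_bool (no_edge_between M S ?W) * (1 - ?p) ^ (L - card M))"
  proof (cases "no_edge_between M S ?W")
    case False
    then have "\<not> no_edge_between (insert e M) S ?W" for e by (auto simp: no_edge_between_def)
    then show ?thesis using False by simp
  next
    case True
    let ?E = "(\<lambda>(v, w). {v, w}) ` (S \<times> ?W)"
    have inj: "inj_on (\<lambda>(v, w). {v, w}) (S \<times> ?W)" by (auto simp: inj_on_def doubleton_eq_iff)
    have "n - 3 * card S \<le> card ?W"
      using card_Diff_subset[OF fST(1) S(1)] diff_card_le_card_Diff[OF fST(2), of "{..<n} - S"] T(2) by simp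
    then have "card S * (n - 3 * card S) \<le> card ?E" using inj by (simp add: card_image card_cartesian_product)
    moreover have "card S * n \<le> 4 * (card S * (n - 3 * card S))"
    proof -
      have "n \<le> 4 * (n - 3 * card S)" using S(2) by linarith
      then have "card S * n \<le> card S * (4 * (n - 3 * card S))" by (rule mult_le_mono2)
      then show ?thesis by simp
    qed
    ultimately have E: "card S * n \<le> 4 * card ?E" by linarith
    have "?E \<subseteq> K_edges n" using S(1) by (auto simp: K_edges_iff)
    moreover have "?E \<inter> M = {}" using True by (auto simp: no_edge_between_def)
    ultimately have "?E - B \<subseteq> ?F" by auto
    have "card ?E - card B \<le> card (?E - B)" by (rule diff_card_le_card_Diff[OF fin(1)])
    moreover have "card B \<le> L" using position_card(1)[OF pos m] lt by linarith
    ultimately have "card S * n \<le> 8 * card (?E - B)" using E L by linarith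
    then have "real (card S) * real n \<le> 8 * real (card (?E - B))" by (metis of_nat_le_iff of_nat_mult of_nat_numeral)
    moreover have "?p * real (card ?F) \<le> ?p * (real n ^ 2 / 2)"
      by (intro mult_left_mono card_unclaimed_le) auto
    moreover have "?p * (real n ^ 2 / 2) = real (card S) * real n / 8" using n by (simp add: power2_eq_square)
    ultimately have p: "?p * real (card ?F) \<le> real (card (?E - B))" by linarith
    have "(\<Sum>e\<in>?F. ?f e) \<le> real (card ?F) * ((1 - (1 - 0) * ?p) * (1 - ?p) ^ (L - Suc (card M)))"
    proof (rule sum_pick_decay[OF fin(3) \<open>?E - B \<subseteq> ?F\<close> p])
      fix e assume "e \<in> ?E - B"
      then have "\<not> no_edge_between (insert e M) S ?W" by (auto simp: no_edge_between_def)
      then show "?f e \<le> 0 * (1 - ?p) ^ (L - Suc (card M))" by simp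
    next
      fix e assume "e \<in> ?F - (?E - B)"
      then have "card (insert e M) = Suc (card M)" using fin by simp
      then show "?f e \<le> (1 - ?p) ^ (L - Suc (card M))" using p01 by (simp add: mult_left_le_one_le)
    qed (use p01 in auto)
    also have "(1 - (1 - 0) * ?p) * (1 - ?p) ^ (L - Suc (card M)) = (1 - ?p) ^ (L - card M)"
      using lt by (metis Suc_diff_Suc diff_zero mult_1 power_Suc)
    finally show ?thesis using True by simp
  qed
qed simp

section \<open>Sparsity of small vertex sets\<close>

lemma power_add_ge:
  fixes x q :: real
  assumes "0 \<le> x" "0 \<le> q"
  shows "x ^ Suc i + real (Suc i) * q * x ^ i \<le> (x + q) ^ Suc i"
proof (induction i)
  case (Suc i)
  have "x ^ Suc (Suc i) + real (Suc (Suc i)) * q * x ^ Suc i + real (Suc i) * q * q * x ^ i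
    = (x + q) * (x ^ Suc i + real (Suc i) * q * x ^ i)" by (simp add: algebra_simps)
  also have "\<dots> \<le> (x + q) * (x + q) ^ Suc i" using Suc assms by (intro mult_left_mono) auto
  finally have "x ^ Suc (Suc i) + real (Suc (Suc i)) * q * x ^ Suc i + real (Suc i) * q * q * x ^ i \<le> (x + q) ^ Suc (Suc i)"
    by simp
  moreover have "0 \<le> real (Suc i) * q * q * x ^ i" using assms by simp
  ultimately show ?case by linarith
qed simp

text \<open>Union bound for Maker completing \<open>Q\<close>: each missing edge is assigned one of
  the \<open>L - card M\<close> remaining picks, and a given pick takes a given edge with
  probability at most \<open>q\<close>. By \<open>0 ^ 0 = 1\<close> the value at
  \<open>card M = L\<close> is 1 exactly if \<open>Q \<subseteq> M\<close>.\<close>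

lemma dense_supermartingale:
  assumes Q: "finite Q" and q: "0 \<le> q" "1 \<le> q * (real (card (K_edges n)) - 2 * real L)" and m: "0 < m"
  shows "supermartingale n m 0 L (\<lambda>j B M. (real (L - card M) * q) ^ card (Q - M))"
proof (rule supermartingaleI)
  fix B M j assume pos: "position n m B M (Suc j)" and lt: "card M < L"
  let ?F = "K_edges n - (B \<union> M)" and ?j = "card (Q - M)"
  define x where "x = real (L - Suc (card M)) * q"
  have fin: "finite B" "finite M" "finite ?F" using finite_position[OF pos] finite_K_edges by auto
  have x0: "0 \<le> x" using q by (simp add: x_def)
  have xq: "real (L - card M) * q = x + q" using lt by (simp add: x_def of_nat_diff algebra_simps)
  have "card (K_edges n) - card (B \<union> M) \<le> card ?F" using fin by (intro diff_card_le_card_Diff) auto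
  moreover have "card (B \<union> M) \<le> card B + card M" by (rule card_Un_le)
  ultimately have "card (K_edges n) \<le> card ?F + 2 * L" using position_card(1)[OF pos m] lt by linarith
  then have "real (card (K_edges n)) - 2 * real L \<le> real (card ?F)" by linarith
  then have "q * (real (card (K_edges n)) - 2 * real L) \<le> q * real (card ?F)" using q(1) by (rule mult_left_mono)
  then have qF: "1 \<le> q * real (card ?F)" using q(2) by linarith
  have val: "(real (L - card (insert e M)) * q) ^ card (Q - insert e M) = (if e \<in> Q then x ^ (?j - 1) else x ^ ?j)"
    if e: "e \<in> ?F" for e
  proof -
    have "Q - insert e M = (Q - M) - {e}" by auto
    then have "card (Q - insert e M) = (if e \<in> Q then ?j - 1 else ?j)" using e Q by simp
    then show ?thesis using e fin by (simp add: x_def)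
  qed
  show "(\<Sum>e\<in>?F. (real (L - card (insert e M)) * q) ^ card (Q - insert e M)) \<le> real (card ?F) * (real (L - card M) * q) ^ ?j"
  proof (cases ?j)
    case 0
    then have "(\<Sum>e\<in>?F. (real (L - card (insert e M)) * q) ^ card (Q - insert e M)) = (\<Sum>e\<in>?F. 1)"
      using val by (intro sum.cong) auto
    then show ?thesis using 0 by simp
  next
    case (Suc i)
    have "(\<Sum>e\<in>?F. (real (L - card (insert e M)) * q) ^ card (Q - insert e M)) \<le> (\<Sum>e\<in>?F. x ^ Suc i + of_bool (e \<in> Q) * x ^ i)"
      using val Suc x0 by (intro sum_mono) auto
    also have "\<dots> = real (card ?F) * x ^ Suc i + real (card (?F \<inter> Q)) * x ^ i"
      using fin by (simp add: sum.distrib sum_distrib_right[symmetric] Int_def)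
    also have "\<dots> \<le> real (card ?F) * x ^ Suc i + (q * real (card ?F)) * real (Suc i) * x ^ i"
    proof -
      have "?F \<inter> Q \<subseteq> Q - M" by auto
      then have "real (card (?F \<inter> Q)) \<le> real (Suc i)" unfolding Suc[symmetric] using Q by (simp add: card_mono)
      also have "\<dots> \<le> (q * real (card ?F)) * real (Suc i)" using mult_right_mono[OF qF, of "real (Suc i)"] by simp
      finally show ?thesis using x0 by (intro add_left_mono mult_right_mono) auto
    qed
    also have "\<dots> = real (card ?F) * (x ^ Suc i + real (Suc i) * q * x ^ i)" by (simp add: algebra_simps)
    \<comment> \<open>The bracket consists of the two leading terms of the binomial
      expansion.\<close>
    also have "\<dots> \<le> real (card ?F) * (x + q) ^ Suc i" using power_add_ge[OF x0 q(1)] by (intro mult_left_mono) auto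
    finally show ?thesis by (simp add: xq Suc)
  qed
qed simp

text \<open>At most \<open>n - path_number n M\<close> lengthenings and one closing edge separate an
  expander from a Hamilton cycle; each success halves the weight. A graph that is no expander counts
  as failed, and the cap at 1 is for picks that turn it into an expander.\<close>

definition booster_potential :: "nat \<Rightarrow> nat \<Rightarrow> edge set \<Rightarrow> real" where
  "booster_potential n L M =
    (if \<not> expander n M then 1 else if has_hamilton_cycle {..<n} M then 0
     else min 1 (2 ^ (n + 1 - path_number n M) * (63/64) ^ (L - card M)))"

text \<open>Of at least n^2/32 boosters Breaker owns at most \<open>L\<close>, hence at most n^2/64,
  so a pick is a booster with probability at least (n^2/64) / (n^2/2) = 1/32. Halving then gives the
  mean factor 1 - 1/64.\<close>

lemma booster_supermartingale:
  assumes n: "9 \<le> n" and m: "0 < m" and L: "64 * L \<le> n ^ 2"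
  shows "supermartingale n m L0 L (\<lambda>j B M. booster_potential n L M)"
proof (rule supermartingaleI)
  fix B M j assume pos: "position n m B M (Suc j)" and lt: "card M < L"
  let ?F = "K_edges n - (B \<union> M)" and ?f = "\<lambda>e. booster_potential n L (insert e M)"
  have fin: "finite B" "finite M" "finite ?F" using finite_position[OF pos] finite_K_edges by auto
  have MK: "M \<subseteq> K_edges n" using pos by (simp add: position_def)
  have le1: "?f e \<le> 1" for e by (simp add: booster_potential_def)
  have sum1: "(\<Sum>e\<in>?F. ?f e) \<le> real (card ?F)" using sum_bounded_above[of ?F ?f 1] le1 by simp
  show "(\<Sum>e\<in>?F. ?f e) \<le> real (card ?F) * booster_potential n L M"
  proof (cases "expander n M \<and> \<not> has_hamilton_cycle {..<n} M")
    case False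
    show ?thesis
    proof (cases "expander n M")
      case True
      then have ham: "has_hamilton_cycle {..<n} M" using False by simp
      have "?f e = 0" if "e \<in> ?F" for e
        using expander_mono[OF True, of "insert e M"] has_hamilton_cycle_mono[OF ham, of "insert e M"] that MK
        by (auto simp: booster_potential_def)
      then show ?thesis using True ham by (simp add: booster_potential_def)
    qed (use sum1 in \<open>simp add: booster_potential_def\<close>)
  next
    case True
    then have ex: "expander n M" and nh: "\<not> has_hamilton_cycle {..<n} M" by auto
    let ?r = "n + 1 - path_number n M"
    define y where "y = 2 ^ ?r * (63/64 :: real) ^ (L - Suc (card M))"
    have pn: "path_number n M \<le> n" using longest_path_exists[of n M] is_path_length n by (metis gr0I not_numeral_le_zero)
    have bd: "?f e \<le> 2 ^ (n + 1 - path_number n (insert e M)) * (63/64) ^ (L - Suc (card M))" if "e \<in> ?F" for e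
      using that fin expander_mono[OF ex, of "insert e M"] MK by (auto simp: booster_potential_def)
    \<comment> \<open>Adding an edge already in \<open>M\<close> changes nothing, so for a
      non-Hamiltonian \<open>M\<close> it cannot be a booster.\<close>
    have disj: "boosters n M \<inter> M = {}" using nh by (auto simp: boosters_def insert_absorb)
    let ?A = "boosters n M - B"
    have AF: "?A \<subseteq> ?F" using disj by (auto simp: boosters_def)
    have "card (boosters n M) - card B \<le> card ?A" by (rule diff_card_le_card_Diff[OF fin(1)])
    moreover have "card B \<le> L" using position_card(1)[OF pos m] lt by linarith
    ultimately have "real (card (boosters n M)) \<le> real (card ?A) + real L" by linarith
    moreover have "64 * real L \<le> real n ^ 2" using L by (metis of_nat_le_iff of_nat_mult of_nat_numeral of_nat_power)
    ultimately have "real n ^ 2 / 64 \<le> real (card ?A)" using card_boosters[OF ex MK n] by linarith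
    then have p: "1/32 * real (card ?F) \<le> real (card ?A)" using card_unclaimed_le[of n "B \<union> M"] by linarith
    have "(\<Sum>e\<in>?F. ?f e) \<le> real (card ?F) * ((1 - (1 - 1/2) * (1/32)) * y)"
    proof (rule sum_pick_decay[OF fin(3) AF p])
      fix e assume e: "e \<in> ?A"
      then have eF: "e \<in> ?F" using AF by blast
      show "?f e \<le> 1/2 * y"
      proof (cases "has_hamilton_cycle {..<n} (insert e M)")
        case True
        then show ?thesis using eF expander_mono[OF ex, of "insert e M"] MK by (auto simp: booster_potential_def y_def)
      next
        case False
        then have "path_number n M < path_number n (insert e M)" using e by (auto simp: boosters_def)
        then have "Suc (n + 1 - path_number n (insert e M)) \<le> ?r" using pn by linarith
        then have "(2::real) ^ Suc (n + 1 - path_number n (insert e M)) \<le> 2 ^ ?r" by (intro power_increasing) auto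
        then have "2 ^ (n + 1 - path_number n (insert e M)) * (63/64) ^ (L - Suc (card M)) \<le> 1/2 * y"
          unfolding y_def by (simp add: mult_right_mono)
        then show ?thesis using bd[OF eF] by linarith
      qed
    next
      fix e assume e: "e \<in> ?F - ?A"
      have "path_number n M \<le> path_number n (insert e M)" using n by (intro path_number_mono) auto
      then have "(2::real) ^ (n + 1 - path_number n (insert e M)) \<le> 2 ^ ?r" by (intro power_increasing) auto
      then have "2 ^ (n + 1 - path_number n (insert e M)) * (63/64) ^ (L - Suc (card M)) \<le> y"
        unfolding y_def by (simp add: mult_right_mono)
      then show "?f e \<le> y" using bd[of e] e by auto
    qed (auto simp: y_def)
    also have "(1 - (1 - 1/2) * (1/32)) * y = 2 ^ ?r * (63/64) ^ (L - card M)"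
      using lt by (simp add: y_def Suc_diff_Suc[symmetric])
    finally have "(\<Sum>e\<in>?F. ?f e) \<le> real (card ?F) * (2 ^ ?r * (63/64) ^ (L - card M))" .
    then show ?thesis using sum1 ex nh by (simp add: booster_potential_def min_def)
  qed
qed simp

section \<open>Hamiltonicity\<close>

text \<open>Let \<open>S\<close> violate expansion. If it is large, its outer neighbours extend to a
  \<open>T\<close> of size \<open>2 * card S\<close>, and Maker has no edge from \<open>S\<close> to
  the rest. If it is small, it forms with its outer neighbours a set \<open>Z\<close> of at most
  \<open>3 * card S\<close> vertices containing all Maker edges at \<open>S\<close>. By minimum
  degree 12 there are at least \<open>6 * card S\<close> of these, which is too many for a sparse
  \<open>Z\<close>.\<close>

lemma expanderI:
  assumes M: "M \<subseteq> K_edges n"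
    and degs: "\<And>v. v < n \<Longrightarrow> 12 \<le> deg M v"
    and cuts: "\<And>S T. S \<subseteq> {..<n} \<Longrightarrow> s \<le> card S \<Longrightarrow> card S \<le> n div 4 \<Longrightarrow> T \<subseteq> {..<n} \<Longrightarrow> card T = 2 * card S \<Longrightarrow>
        \<not> no_edge_between M S ({..<n} - S - T)"
    and sparse: "\<And>Z Q. Z \<subseteq> {..<n} \<Longrightarrow> Z \<noteq> {} \<Longrightarrow> card Z \<le> 3 * s \<Longrightarrow> Q \<subseteq> [Z]\<^bsup>2\<^esup> \<Longrightarrow> card Q = 2 * card Z \<Longrightarrow> \<not> Q \<subseteq> M"
  shows "expander n M"
  unfolding expander_def
proof (intro allI impI, rule ccontr)
  fix S assume S: "S \<subseteq> {..<n}" "S \<noteq> {}" "card S \<le> n div 4" and "\<not> 2 * card S < card (outer_nbrs M S)"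
  then have N: "card (outer_nbrs M S) \<le> 2 * card S" by simp
  have Nn: "outer_nbrs M S \<subseteq> {..<n}" by (rule outer_nbrs_subset[OF M])
  have fin: "finite S" "finite (outer_nbrs M S)" "finite M"
    using S(1) Nn M finite_subset finite_K_edges by blast+
  show False
  proof (cases "s \<le> card S")
    case True
    have "2 * card S \<le> card {..<n}" using S(3) by simp
    then obtain T where T: "outer_nbrs M S \<subseteq> T" "T \<subseteq> {..<n}" "card T = 2 * card S"
      using exists_subset_between[OF N _ Nn] by blast
    have "no_edge_between M S ({..<n} - S - T)" using T(1) by (auto simp: no_edge_between_def outer_nbrs_def)
    then show False using cuts[OF S(1) True S(3) T(2,3)] by simp
  next
    case False
    define Z where "Z = S \<union> outer_nbrs M S"
    define Y where "Y = {e \<in> M. e \<inter> S \<noteq> {}}"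
    have cZ: "card Z \<le> 3 * card S" using card_Un_le[of S "outer_nbrs M S"] N by (simp add: Z_def)
    have Zn: "Z \<subseteq> {..<n}" using S(1) Nn by (simp add: Z_def)
    have fY: "finite Y" using fin by (simp add: Y_def)
    have e2: "finite e \<and> card e = 2" if "e \<in> Y" for e using that M by (auto simp: Y_def K_edges_def nsets_def)
    have YZ: "Y \<subseteq> [Z]\<^bsup>2\<^esup>"
    proof
      fix e assume e: "e \<in> Y"
      then obtain a where a: "a \<in> e" "a \<in> S" "e \<in> M" by (auto simp: Y_def)
      obtain b where "e = {a, b}" using a e2[OF e] by (auto simp: card_2_iff)
      then have "e \<subseteq> Z" using a by (auto simp: Z_def outer_nbrs_def)
      then show "e \<in> [Z]\<^bsup>2\<^esup>" using e2[OF e] by (simp add: nsets_def)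
    qed
    \<comment> \<open>Double counting: an edge contributes at most 2 to the degree sum over
      \<open>S\<close>.\<close>
    have "(\<Sum>v\<in>S. 12) \<le> (\<Sum>v\<in>S. deg M v)" using degs S(1) by (intro sum_mono) auto
    also have "\<dots> = (\<Sum>v\<in>S. \<Sum>e\<in>{e \<in> Y. v \<in> e}. 1)"
    proof (rule sum.cong[OF refl])
      fix v assume "v \<in> S"
      then have "{e \<in> M. v \<in> e} = {e \<in> Y. v \<in> e}" by (auto simp: Y_def)
      then show "deg M v = (\<Sum>e\<in>{e \<in> Y. v \<in> e}. 1)" by (simp add: deg_def)
    qed
    also have "\<dots> = (\<Sum>e\<in>Y. \<Sum>v\<in>{v \<in> S. v \<in> e}. 1)" by (rule sum.swap_restrict[OF fin(1) fY])
    also have "\<dots> \<le> (\<Sum>e\<in>Y. 2)"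
    proof (rule sum_mono)
      fix e assume e: "e \<in> Y"
      have "card {v \<in> S. v \<in> e} \<le> card e" using e2[OF e] by (intro card_mono) auto
      then show "(\<Sum>v\<in>{v \<in> S. v \<in> e}. 1) \<le> (2::nat)" using e2[OF e] by simp
    qed
    finally have "2 * card Z \<le> card Y" using cZ by simp
    then obtain Q where Q: "Q \<subseteq> Y" "card Q = 2 * card Z" using obtain_subset_with_card_n by metis
    have "\<not> Q \<subseteq> M" using S(2) cZ False Q YZ by (intro sparse[OF Zn]) (auto simp: Z_def)
    then show False using Q(1) by (auto simp: Y_def)
  qed
qed

section \<open>Union bounds over cuts and dense sets\<close>

definition cut_pairs :: "nat \<Rightarrow> nat \<Rightarrow> (nat set \<times> nat set) set" where
  "cut_pairs n s = (SIGMA S:{S. S \<subseteq> {..<n} \<and> s \<le> card S \<and> card S \<le> n div 4}. {T. T \<subseteq> {..<n} \<and> card T = 2 * card S})"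

definition dense_sets :: "nat \<Rightarrow> nat \<Rightarrow> (nat set \<times> edge set) set" where
  "dense_sets n s = (SIGMA Z:{Z. Z \<subseteq> {..<n} \<and> Z \<noteq> {} \<and> card Z \<le> 3 * s}. {Q. Q \<subseteq> [Z]\<^bsup>2\<^esup> \<and> card Q = 2 * card Z})"

lemma finite_dense_fiber:
  assumes "Z \<subseteq> {..<n::nat}"
  shows "finite {Q. Q \<subseteq> [Z]\<^bsup>2\<^esup> \<and> card Q = k}"
proof -
  have "finite Z" using assms by (rule finite_subset) simp
  then have "finite (Pow ([Z]\<^bsup>2\<^esup>))" by (simp add: finite_imp_finite_nsets)
  then show ?thesis by (rule rev_finite_subset) blast
qed

lemma finite_dense_sets: "finite (dense_sets n s)"
  unfolding dense_sets_def
proof (rule finite_SigmaI)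
  fix Z assume "Z \<in> {Z. Z \<subseteq> {..<n} \<and> Z \<noteq> {} \<and> card Z \<le> 3 * s}"
  then show "finite {Q. Q \<subseteq> [Z]\<^bsup>2\<^esup> \<and> card Q = 2 * card Z}" by (simp add: finite_dense_fiber[of Z n])
qed simp

lemma finite_cut_pairs: "finite (cut_pairs n s)"
  unfolding cut_pairs_def by (intro finite_SigmaI) auto

lemma binomial_le_power: "real (n choose k) \<le> real n ^ k"
proof (cases "k \<le> n")
  case True
  then show ?thesis using binomial_le_pow[of k n] by (metis of_nat_le_iff of_nat_power)
qed (simp add: binomial_eq_0)

lemma sum_over_subsets_le:
  fixes f :: "nat \<Rightarrow> real"
  assumes A: "A \<subseteq> {S. S \<subseteq> {..<n} \<and> card S \<in> I}" and I: "finite I" and f: "\<And>s. s \<in> I \<Longrightarrow> 0 \<le> f s"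
  shows "(\<Sum>S\<in>A. f (card S)) \<le> (\<Sum>s\<in>I. real n ^ s * f s)"
proof -
  have "finite A" using A by (rule finite_subset) auto
  then have "(\<Sum>S\<in>A. f (card S)) = (\<Sum>s\<in>I. \<Sum>S\<in>{S \<in> A. card S = s}. f (card S))"
    using A I by (intro sum.group[symmetric]) auto
  also have "\<dots> = (\<Sum>s\<in>I. real (card {S \<in> A. card S = s}) * f s)"
    by (intro sum.cong refl) simp
  also have "\<dots> \<le> (\<Sum>s\<in>I. real n ^ s * f s)"
  proof (intro sum_mono mult_right_mono f)
    fix s
    have "card {S \<in> A. card S = s} \<le> card {S. S \<subseteq> {..<n} \<and> card S = s}"
      using A by (intro card_mono) auto
    also have "\<dots> = n choose s" by (simp add: n_subsets)
    finally show "real (card {S \<in> A. card S = s}) \<le> real n ^ s" using binomial_le_power[of n s] by linarith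
  qed
  finally show ?thesis .
qed

lemma sum_powers_le:
  fixes x :: real
  assumes "0 \<le> x" "x \<le> 1" "I \<subseteq> {1..N}"
  shows "(\<Sum>s\<in>I. x ^ s) \<le> real N * x"
proof -
  have fI: "finite I" using assms(3) finite_subset by blast
  have "(\<Sum>s\<in>I. x ^ s) \<le> (\<Sum>s\<in>I. x)"
  proof (rule sum_mono)
    fix s assume "s \<in> I"
    then have "1 \<le> s" using assms(3) by auto
    then show "x ^ s \<le> x" using power_decreasing[of 1 s x] assms by simp
  qed
  also have "\<dots> = real (card I) * x" by simp
  also have "\<dots> \<le> real N * x" using card_mono[OF _ assms(3)] assms(1) by (intro mult_right_mono) auto
  finally show ?thesis .
qed

lemma one_minus_power_le_exp:
  fixes u :: real
  assumes "u \<le> 1"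
  shows "(1 - u) ^ k \<le> exp (- (u * real k))"
proof -
  have "(1 - u) ^ k \<le> exp (- u) ^ k" using assms exp_ge_add_one_self[of "- u"] by (intro power_mono) auto
  then show ?thesis by (simp add: exp_of_nat_mult[symmetric] mult.commute)
qed

text \<open>For \<open>card S = s\<close> there are at most n^s choices of \<open>S\<close> and
  n^(2s) of \<open>T\<close>, and the summand is at most exp(-L/(4n))^s; the product is
  \<open>x ^ s\<close>.\<close>

lemma cut_sum_le:
  fixes n L s0 :: nat
  defines "x \<equiv> real n ^ 3 * exp (- (real L / (4 * real n)))"
  assumes "0 < n" "0 < s0" "x \<le> 1"
  shows "(\<Sum>(S, T)\<in>cut_pairs n s0. (1 - real (card S) / (4 * real n)) ^ L) \<le> real n * x"
proof -
  let ?A = "{S. S \<subseteq> {..<n} \<and> s0 \<le> card S \<and> card S \<le> n div 4}" and ?I = "{s0..n div 4}"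
  let ?c = "\<lambda>s. (1 - real s / (4 * real n)) ^ L"
  have c0: "0 \<le> ?c s \<and> ?c s \<le> exp (- (real L / (4 * real n))) ^ s" if "s \<le> n div 4" for s
  proof -
    have u: "real s / (4 * real n) \<le> 1" using that assms(2) by (simp add: field_simps)
    then have "?c s \<le> exp (- (real s / (4 * real n) * real L))" by (rule one_minus_power_le_exp)
    also have "\<dots> = exp (- (real L / (4 * real n))) ^ s" by (simp add: exp_of_nat_mult[symmetric])
    finally show ?thesis using u by simp
  qed
  have "(\<Sum>(S, T)\<in>cut_pairs n s0. ?c (card S)) = (\<Sum>S\<in>?A. \<Sum>T\<in>{T. T \<subseteq> {..<n} \<and> card T = 2 * card S}. ?c (card S))"
    unfolding cut_pairs_def by (rule sum.Sigma[symmetric]) auto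
  also have "\<dots> = (\<Sum>S\<in>?A. real (n choose (2 * card S)) * ?c (card S))"
    by (simp add: n_subsets)
  also have "\<dots> \<le> (\<Sum>s\<in>?I. real n ^ s * (real (n choose (2 * s)) * ?c s))"
    using c0 by (intro sum_over_subsets_le[where f = "\<lambda>s. real (n choose (2 * s)) * ?c s"]) auto
  also have "\<dots> \<le> (\<Sum>s\<in>?I. real n ^ s * (real n ^ (2 * s) * exp (- (real L / (4 * real n))) ^ s))"
    using c0 by (intro sum_mono mult_left_mono mult_mono binomial_le_power) auto
  also have "\<dots> = (\<Sum>s\<in>?I. x ^ s)"
    by (simp add: x_def power_mult_distrib power_mult[symmetric] power_add[symmetric] mult.assoc[symmetric])
  also have "\<dots> \<le> real n * x"
    using assms(3,4) by (intro sum_powers_le) (auto simp: x_def)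
  finally show ?thesis .
qed

text \<open>For \<open>card Z = s\<close> there are at most n^s choices of \<open>Z\<close>. It
  spans at most (3 s0)^2 pairs, which leaves at most that number to the power 2s choices of
  \<open>Q\<close>; with the weight p^(2s) the product is \<open>y ^ s\<close>.\<close>

lemma dense_sum_le:
  fixes n s0 :: nat and p :: real
  defines "y \<equiv> real n * (real (3 * s0) ^ 2 * p) ^ 2"
  assumes "0 \<le> p" "y \<le> 1"
  shows "(\<Sum>(Z, Q)\<in>dense_sets n s0. p ^ card Q) \<le> real (3 * s0) * y"
proof -
  let ?A = "{Z. Z \<subseteq> {..<n} \<and> Z \<noteq> {} \<and> card Z \<le> 3 * s0}" and ?I = "{1..3 * s0}"
  have "(\<Sum>(Z, Q)\<in>dense_sets n s0. p ^ card Q) = (\<Sum>Z\<in>?A. \<Sum>Q\<in>{Q. Q \<subseteq> [Z]\<^bsup>2\<^esup> \<and> card Q = 2 * card Z}. p ^ card Q)"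
    unfolding dense_sets_def by (rule sum.Sigma[symmetric]) (simp_all add: finite_dense_fiber[where n = n])
  also have "\<dots> \<le> (\<Sum>Z\<in>?A. (real (3 * s0) ^ 2) ^ (2 * card Z) * p ^ (2 * card Z))"
  proof (rule sum_mono)
    fix Z assume Z: "Z \<in> ?A"
    then have fZ: "finite Z" using finite_subset by blast
    have "(\<Sum>Q\<in>{Q. Q \<subseteq> [Z]\<^bsup>2\<^esup> \<and> card Q = 2 * card Z}. p ^ card Q) = real ((card Z choose 2) choose (2 * card Z)) * p ^ (2 * card Z)"
      using n_subsets[OF finite_imp_finite_nsets[OF fZ], of 2 "2 * card Z"] by simp
    also have "\<dots> \<le> (real (3 * s0) ^ 2) ^ (2 * card Z) * p ^ (2 * card Z)"
    proof (rule mult_right_mono)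
      have "real (card Z choose 2) \<le> real (card Z) ^ 2" by (rule binomial_le_power)
      also have "\<dots> \<le> real (3 * s0) ^ 2" using Z by (intro power_mono) auto
      finally have "real (card Z choose 2) ^ (2 * card Z) \<le> (real (3 * s0) ^ 2) ^ (2 * card Z)"
        by (intro power_mono) auto
      then show "real ((card Z choose 2) choose (2 * card Z)) \<le> (real (3 * s0) ^ 2) ^ (2 * card Z)"
        using binomial_le_power[of "card Z choose 2" "2 * card Z"] by linarith
    qed (use assms(2) in simp)
    finally show "(\<Sum>Q\<in>{Q. Q \<subseteq> [Z]\<^bsup>2\<^esup> \<and> card Q = 2 * card Z}. p ^ card Q) \<le> (real (3 * s0) ^ 2) ^ (2 * card Z) * p ^ (2 * card Z)" .
  qed
  also have "\<dots> \<le> (\<Sum>s\<in>?I. real n ^ s * ((real (3 * s0) ^ 2) ^ (2 * s) * p ^ (2 * s)))"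
    using assms(2) finite_subset
    by (intro sum_over_subsets_le[where f = "\<lambda>s. (real (3 * s0) ^ 2) ^ (2 * s) * p ^ (2 * s)"]) (auto simp: Suc_le_eq card_gt_0_iff)
  also have "\<dots> = (\<Sum>s\<in>?I. y ^ s)"
    unfolding y_def by (simp only: power_mult_distrib power_mult)
  also have "\<dots> \<le> real (3 * s0) * y" using assms by (intro sum_powers_le) auto
  finally show ?thesis .
qed

text \<open>Two phases of \<open>L\<close> picks each. In the first, the potential is the sum of the
  degree, cut and dense-set potentials and a constant reserve. At the switch, a graph that is no
  expander makes one of the three at least 1, and for an expander the reserve pays for the booster
  potential of the second phase. The bound estimates the value at the empty position.\<close>

lemma hamilton_failure_bound:
  fixes n m m0 l :: nat
  defines "L \<equiv> n * l ^ 2" and "\<rho> \<equiv> 1 - 1 / (3 * real n)" and "\<alpha> \<equiv> real m0 / (3 * real n)"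
  defines "G \<equiv> (1/2) ^ 11 * (exp (\<alpha> * real (n div 2)) - 1)"
    and "x \<equiv> real n ^ 3 * exp (- (real L / (4 * real n)))"
    and "y \<equiv> real n * (real (3 * (8 * l ^ 2)) ^ 2 * (real L * (4 / real n ^ 2))) ^ 2"
  assumes n: "72 \<le> n" and m: "0 < m0" "m0 \<le> m" and l: "0 < l" "128 * L \<le> n ^ 2"
    and x: "x \<le> 1" and y: "y \<le> 1" and strat: "breaker_strategy n \<sigma>"
  shows "measure_pmf.prob (random_maker_game n m \<sigma>) {h. \<not> has_hamilton_cycle {..<n} (maker_graph h)}
    \<le> real n * (2 ^ 11 * \<rho> ^ L) + (real L / real m0 + 1) * (2 * (exp \<alpha> - 1) / G)
      + real n * x + real (3 * (8 * l ^ 2)) * y + 2 ^ n * (63/64) ^ L"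
proof -
  \<comment> \<open>\<open>s0\<close> makes \<open>8 * L \<le> card S * n\<close> hold for all cuts
    considered; \<open>q\<close> fits the at least n^2/4 edges that stay unclaimed; \<open>R\<close>
    bounds the number of Breaker edges in the first phase.\<close>
  define s0 where "s0 = 8 * l ^ 2"
  define q where "q = 4 / real n ^ 2"
  define R where "R = real L / real m0 + 1"
  have m': "0 < m" using m by simp
  have n0: "0 < real n" using n by simp
  have \<alpha>0: "0 < \<alpha>" using m n by (simp add: \<alpha>_def)
  have \<rho>0: "0 \<le> \<rho>" "\<rho> \<le> 1" using n by (simp_all add: \<rho>_def field_simps)
  have Gpos: "0 < G" using \<alpha>0 n by (simp add: G_def)
  \<comment> \<open>The weights are tuned to \<open>m0\<close>; additional picks only help, so
    \<open>m\<close> may be arbitrarily large.\<close>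
  have "\<rho> ^ m \<le> \<rho> ^ m0" using \<rho>0 m by (intro power_decreasing) auto
  also have "\<dots> \<le> exp (- \<alpha>)"
    using one_minus_power_le_exp[of "1 / (3 * real n)" m0] n by (simp add: \<rho>_def \<alpha>_def)
  finally have "exp \<alpha> * \<rho> ^ m \<le> exp \<alpha> * exp (- \<alpha>)" by (intro mult_left_mono) auto
  then have \<alpha>\<rho>: "exp \<alpha> * \<rho> ^ m \<le> 1" by (simp add: exp_minus)
  have L128: "128 * real L \<le> real n ^ 2" using l(2) by (metis of_nat_le_iff of_nat_mult of_nat_numeral of_nat_power)
  have nn: "72 * real n \<le> real n ^ 2" using n by (simp add: power2_eq_square)
  have K: "real (card (K_edges n)) = (real n ^ 2 - real n) / 2" by (simp add: card_K_edges power2_eq_square algebra_simps)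
  \<comment> \<open>Used with \<open>a = n^2\<close>, \<open>b = n\<close> and \<open>c = L\<close>;
    5184 is 72 squared.\<close>
  have arith: "a / 4 \<le> (a - b) / 2 - 2 * c" "5184 \<le> a \<Longrightarrow> 2 * (2 * c) + 1 < (a - b) / 2"
    if "128 * c \<le> a" "72 * b \<le> a" "0 \<le> a" for a b c :: real using that by argo+
  have q: "0 \<le> q" "1 \<le> q * (real (card (K_edges n)) - 2 * real L)"
  proof -
    show q0: "0 \<le> q" by (simp add: q_def)
    have "real n ^ 2 / 4 \<le> real (card (K_edges n)) - 2 * real L" unfolding K by (rule arith(1)[OF L128 nn]) simp
    then have "q * (real n ^ 2 / 4) \<le> q * (real (card (K_edges n)) - 2 * real L)" using q0 by (rule mult_left_mono)
    then show "1 \<le> q * (real (card (K_edges n)) - 2 * real L)" using n by (simp add: q_def)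
  qed
  have "72 * 72 \<le> 72 * real n" using n by simp
  then have "5184 \<le> real n ^ 2" using nn by linarith
  then have "2 * (2 * real L) + 1 < real (card (K_edges n))" unfolding K by (intro arith(2)[OF L128 nn]) auto
  then have board: "2 * (2 * L) + 1 < card (K_edges n)" by linarith
  define D where "D = (\<lambda>j B M. (\<Sum>v<n. degree_potential n \<rho> \<alpha> G L v j B M) + (R - real (card B)) * (2 * (exp \<alpha> - 1) / G))"
  define C where "C = (\<lambda>M. \<Sum>z\<in>cut_pairs n s0. of_bool (no_edge_between M (fst z) ({..<n} - fst z - snd z)) * (1 - real (card (fst z)) / (4 * real n)) ^ (L - card M))"
  define H where "H = (\<lambda>M. \<Sum>z\<in>dense_sets n s0. (real (L - card M) * q) ^ card (snd z - M))"
  define \<Psi> where "\<Psi> = (\<lambda>(j::nat) B M. D j B M + C M + H M + 2 ^ n * (63/64) ^ L)"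
  have supD: "supermartingale n m 0 L D"
    unfolding D_def by (rule degree_supermartingale[OF n \<rho>_def[THEN meta_eq_to_obj_eq] less_imp_le[OF \<alpha>0] \<alpha>\<rho> G_def[THEN meta_eq_to_obj_eq] Gpos])
  have "supermartingale n m 0 L (\<lambda>j B M. C M)"
    unfolding C_def
  proof (rule supermartingale_sum)
    fix z assume z: "z \<in> cut_pairs n s0"
    then have "l ^ 2 * 8 * n \<le> card (fst z) * n" by (intro mult_right_mono) (auto simp: cut_pairs_def s0_def)
    then show "supermartingale n m 0 L (\<lambda>j B M. of_bool (no_edge_between M (fst z) ({..<n} - fst z - snd z)) * (1 - real (card (fst z)) / (4 * real n)) ^ (L - card M))"
      using z n m' by (intro cut_supermartingale) (auto simp: cut_pairs_def L_def algebra_simps)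
  qed
  moreover have "supermartingale n m 0 L (\<lambda>j B M. H M)"
    unfolding H_def
  proof (rule supermartingale_sum)
    fix z assume "z \<in> dense_sets n s0"
    then have z: "fst z \<subseteq> {..<n}" "snd z \<subseteq> [fst z]\<^bsup>2\<^esup>" by (auto simp: dense_sets_def)
    have "finite (fst z)" using z(1) by (rule finite_subset) simp
    then have "finite (snd z)" using z(2) by (meson finite_imp_finite_nsets finite_subset)
    then show "supermartingale n m 0 L (\<lambda>j B M. (real (L - card M) * q) ^ card (snd z - M))"
      using q m' by (intro dense_supermartingale)
  qed
  ultimately have sup1: "supermartingale n m 0 L \<Psi>"
    unfolding \<Psi>_def by (intro supermartingale_add supD supermartingale_const)
  have sup2: "supermartingale n m L (2 * L) (\<lambda>j B M. booster_potential n (2 * L) M)"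
    using n l(2) by (intro booster_supermartingale m') auto
  have C0: "0 \<le> of_bool b * (1 - real (card (fst z)) / (4 * real n)) ^ k" if "z \<in> cut_pairs n s0" for z b k
    using that n0 by (auto simp: cut_pairs_def field_simps intro!: mult_nonneg_nonneg zero_le_power)
  have H0: "0 \<le> (real k * q) ^ i" for k i using q(1) by simp
  have fin: "finite (cut_pairs n s0)" "finite (dense_sets n s0)" by (rule finite_cut_pairs finite_dense_sets)+
  have link: "booster_potential n (2 * L) M \<le> \<Psi> j B M" if pos: "position n m B M j" and cM: "card M = L" for j B M
  proof -
    have MK: "M \<subseteq> K_edges n" using pos by (simp add: position_def)
    have Dp0: "0 \<le> degree_potential n \<rho> \<alpha> G L v j B M" for v using \<rho>0 \<alpha>0 Gpos by (intro degree_potential_nonneg) auto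
    \<comment> \<open>All Breaker edges but the latest have been answered by at least
      \<open>m0\<close> picks, so the account in \<open>D\<close> is not overdrawn.\<close>
    have "m0 * (card B - 1) \<le> m * (card B - 1)" using m by simp
    then have "m0 * (card B - 1) \<le> L" using position_card(2)[OF pos m'] cM by linarith
    then have "real m0 * real (card B - 1) \<le> real L" by (metis of_nat_le_iff of_nat_mult)
    then have "real (card B - 1) \<le> real L / real m0" using m by (simp add: field_simps)
    then have "0 \<le> R - real (card B)" by (simp add: R_def)
    then have add0: "0 \<le> (R - real (card B)) * (2 * (exp \<alpha> - 1) / G)" using \<alpha>0 Gpos by simp
    have D0: "0 \<le> D j B M" unfolding D_def by (intro add_nonneg_nonneg sum_nonneg Dp0 add0)
    have CM0: "0 \<le> C M" unfolding C_def by (intro sum_nonneg C0)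
    have HM0: "0 \<le> H M" unfolding H_def by (intro sum_nonneg H0)
    show ?thesis
    proof (cases "expander n M")
      case True
      have "booster_potential n (2 * L) M \<le> 2 ^ (n + 1 - path_number n M) * (63/64) ^ (2 * L - card M)"
        using True by (auto simp: booster_potential_def)
      also have "\<dots> \<le> 2 ^ n * (63/64) ^ L"
      proof -
        have "(2::real) ^ (n + 1 - path_number n M) \<le> 2 ^ n"
          using path_number_pos[of n M] n by (intro power_increasing) auto
        moreover have "2 * L - card M = L" using cM by simp
        ultimately show ?thesis by (simp add: mult_right_mono)
      qed
      finally show ?thesis using D0 CM0 HM0 by (simp add: \<Psi>_def)
    next
      case False
      then have b1: "booster_potential n (2 * L) M = 1" by (simp add: booster_potential_def)
      have "1 \<le> D j B M \<or> 1 \<le> C M \<or> 1 \<le> H M"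
      proof (rule ccontr)
        assume "\<not> ?thesis"
        then have D1: "D j B M < 1" and C1: "C M < 1" and H1: "H M < 1" by auto
        have "expander n M"
        proof (rule expanderI[OF MK, of s0])
          fix v assume v: "v < n"
          show "12 \<le> deg M v"
          proof (rule ccontr)
            assume "\<not> 12 \<le> deg M v"
            then have "1 \<le> degree_potential n \<rho> \<alpha> G L v j B M"
              using \<rho>0 \<alpha>0 Gpos cM by (intro degree_potential_final) auto
            also have "\<dots> \<le> (\<Sum>v<n. degree_potential n \<rho> \<alpha> G L v j B M)"
              using v Dp0 by (intro member_le_sum) auto
            finally show False using D1 add0 by (simp add: D_def)
          qed
        next
          fix S T assume ST: "S \<subseteq> {..<n}" "s0 \<le> card S" "card S \<le> n div 4" "T \<subseteq> {..<n}" "card T = 2 * card S"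
          then have z: "(S, T) \<in> cut_pairs n s0" by (simp add: cut_pairs_def)
          show "\<not> no_edge_between M S ({..<n} - S - T)"
          proof
            assume "no_edge_between M S ({..<n} - S - T)"
            then have "1 = of_bool (no_edge_between M (fst (S, T)) ({..<n} - fst (S, T) - snd (S, T))) * (1 - real (card (fst (S, T))) / (4 * real n)) ^ (L - card M)"
              using cM by simp
            also have "\<dots> \<le> C M" unfolding C_def by (rule member_le_sum[OF z _ fin(1)]) (rule C0, simp)
            finally have "1 \<le> C M" .
            then show False using C1 by simp
          qed
        next
          fix Z Q assume ZQ: "Z \<subseteq> {..<n}" "Z \<noteq> {}" "card Z \<le> 3 * s0" "Q \<subseteq> [Z]\<^bsup>2\<^esup>" "card Q = 2 * card Z"
          then have z: "(Z, Q) \<in> dense_sets n s0" by (simp add: dense_sets_def)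
          show "\<not> Q \<subseteq> M"
          proof
            assume "Q \<subseteq> M"
            then have "card (Q - M) = 0" using Diff_eq_empty_iff[of Q M] by (metis card.empty)
            then have "1 = (real (L - card M) * q) ^ card (snd (Z, Q) - M)" by simp
            also have "\<dots> \<le> H M" unfolding H_def by (rule member_le_sum[OF z H0 fin(2)])
            finally have "1 \<le> H M" .
            then show False using H1 by simp
          qed
        qed
        then show False using False by simp
      qed
      moreover have "0 \<le> (2::real) ^ n * (63/64) ^ L" by simp
      ultimately show ?thesis using b1 D0 CM0 HM0 unfolding \<Psi>_def by linarith
    qed
  qed
  let ?\<Psi> = "\<lambda>j B M. if card M < L then \<Psi> j B M else booster_potential n (2 * L) M"
  have "measure_pmf.prob (random_maker_game n m \<sigma>) {h. \<not> has_hamilton_cycle {..<n} (maker_graph h)} \<le> ?\<Psi> 0 {} {}"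
  proof (rule random_maker_game_bound[where \<Psi> = ?\<Psi> and bad = "\<lambda>M. \<not> has_hamilton_cycle {..<n} M", OF _ m' board strat])
    show "supermartingale n m 0 (2 * L) ?\<Psi>" by (rule supermartingale_append[OF sup1 sup2 link])
  next
    fix M M' assume "M \<subseteq> M'" "\<not> has_hamilton_cycle {..<n} M'"
    then show "\<not> has_hamilton_cycle {..<n} M" using has_hamilton_cycle_mono by blast
  next
    fix j :: nat and B M :: "edge set" assume "card M = 2 * L"
    then show "of_bool (\<not> has_hamilton_cycle {..<n} M) \<le> ?\<Psi> j B M"
      by (auto simp: booster_potential_def min_def)
  qed
  also have "?\<Psi> 0 {} {} = \<Psi> 0 {} {}" using n l(1) by (simp add: L_def)
  also have "\<dots> \<le> real n * (2 ^ 11 * \<rho> ^ L) + R * (2 * (exp \<alpha> - 1) / G) + real n * x + real (3 * s0) * y + 2 ^ n * (63/64) ^ L"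
  proof -
    \<comment> \<open>All Breaker degrees are 0, so the exponential parts vanish; the last summands
      of the weights and the full account remain.\<close>
    have "D 0 {} {} = real n * (2 ^ 11 * \<rho> ^ L) + R * (2 * (exp \<alpha> - 1) / G)"
      by (simp add: D_def degree_potential_def deg_def low_weight_def)
    moreover have "C {} \<le> real n * x"
      using cut_sum_le[of n s0 L] n l(1) x unfolding x_def C_def
      by (simp add: s0_def no_edge_between_def case_prod_beta)
    moreover have "H {} \<le> real (3 * s0) * y"
      using dense_sum_le[of "real L * q" n s0] y q(1) unfolding y_def H_def
      by (simp add: s0_def q_def case_prod_beta)
    ultimately show ?thesis by (simp add: \<Psi>_def)
  qed
  finally show ?thesis unfolding R_def s0_def .
qed

text \<open>The second summand, which stems from the account for Breaker's edges, is of order (ln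
  n)^-2 and decays slowest. The fourth is of order (ln n)^14 / n, the others are smaller than any
  power of n.\<close>

lemma failure_terms_tendsto_zero:
  "((\<lambda>n::nat. real n * (2 ^ 11 * exp (- (ln (real n) ^ 2 / 3))) + 8192 * ((ln (real n) + 1) ^ 2 + 1) / (ln (real n) ^ 4 - 1)
     + real n * (real n ^ 3 * exp (- (ln (real n) ^ 2 / 4)))
     + 24 * (ln (real n) + 1) ^ 2 * (real n * (576 * (ln (real n) + 1) ^ 4 * (4 * (ln (real n) + 1) ^ 2 / real n)) ^ 2)
     + 2 ^ n * exp (- (real n * ln (real n) ^ 2 / 64))) \<longlongrightarrow> 0) sequentially"
  by (intro tendsto_add_zero; real_asymp)

theorem theorem1p5:
  shows "\<exists>A::real. A > 0 \<and>
    (\<forall>(m :: nat \<Rightarrow> nat) (\<sigma> :: nat \<Rightarrow> strategy).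
       (\<forall>\<^sub>F n in sequentially. real (m n) \<ge> A * ln (ln (real n))) \<longrightarrow>
       (\<forall>n. breaker_strategy n (\<sigma> n)) \<longrightarrow>
       (\<lambda>n. measure_pmf.prob (random_maker_game n (m n) (\<sigma> n))
              {h. has_hamilton_cycle {..<n} (maker_graph h)}) \<longlonglongrightarrow> 1)"
proof (intro exI[of _ "28::real"] conjI allI impI)
  \<comment> \<open>28 = 7 * 4: below, \<open>\<alpha> * real (n div 2)\<close> is at least
    \<open>m0 / 7\<close>, so this constant gives a lost vertex a weight of order (ln n)^4, against
    a total of order (ln n)^2.\<close>
  show "(28::real) > 0" by simp
next
  fix m :: "nat \<Rightarrow> nat" and \<sigma> :: "nat \<Rightarrow> strategy"
  assume m: "\<forall>\<^sub>F n in sequentially. real (m n) \<ge> 28 * ln (ln (real n))" and strat: "\<forall>n. breaker_strategy n (\<sigma> n)"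
  let ?P = "\<lambda>n. measure_pmf.prob (random_maker_game n (m n) (\<sigma> n))"
  let ?good = "\<lambda>n. {h. has_hamilton_cycle {..<n} (maker_graph h)}" and ?bad = "\<lambda>n. {h. \<not> has_hamilton_cycle {..<n} (maker_graph h)}"
  define \<delta> where "\<delta> = (\<lambda>n::nat. real n * (2 ^ 11 * exp (- (ln (real n) ^ 2 / 3))) + 8192 * ((ln (real n) + 1) ^ 2 + 1) / (ln (real n) ^ 4 - 1)
     + real n * (real n ^ 3 * exp (- (ln (real n) ^ 2 / 4)))
     + 24 * (ln (real n) + 1) ^ 2 * (real n * (576 * (ln (real n) + 1) ^ 4 * (4 * (ln (real n) + 1) ^ 2 / real n)) ^ 2)
     + 2 ^ n * exp (- (real n * ln (real n) ^ 2 / 64)))"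
  \<comment> \<open>In this order the conditions serve the degree argument, \<open>0 < m0\<close>
    together with \<open>1 < ln n\<close>, \<open>\<alpha> \<le> 1\<close>,
    \<open>128 * L \<le> n ^ 2\<close>, \<open>x \<le> 1\<close> and
    \<open>y \<le> 1\<close>.\<close>
  have "\<forall>\<^sub>F n::nat in sequentially. 72 \<le> real n" by real_asymp
  moreover have "\<forall>\<^sub>F n::nat in sequentially. 0 < ln (ln (real n))" by real_asymp
  moreover have "\<forall>\<^sub>F n::nat in sequentially. 28 * ln (ln (real n)) + 1 \<le> 3 * real n" by real_asymp
  moreover have "\<forall>\<^sub>F n::nat in sequentially. 128 * (ln (real n) + 1) ^ 2 \<le> real n" by real_asymp
  moreover have "\<forall>\<^sub>F n::nat in sequentially. real n ^ 3 * exp (- (ln (real n) ^ 2 / 4)) \<le> 1" by real_asymp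
  moreover have "\<forall>\<^sub>F n::nat in sequentially. real n * (576 * (ln (real n) + 1) ^ 4 * (4 * (ln (real n) + 1) ^ 2 / real n)) ^ 2 \<le> 1" by real_asymp
  ultimately have upper: "\<forall>\<^sub>F n in sequentially. ?P n (?bad n) \<le> \<delta> n"
    using m
  proof eventually_elim
    case (elim n)
    define l where "l = nat \<lceil>ln (real n)\<rceil>"
    define m0 where "m0 = nat \<lceil>28 * ln (ln (real n))\<rceil>"
    define L where "L = n * l ^ 2"
    define \<alpha> where "\<alpha> = real m0 / (3 * real n)"
    define \<rho> where "\<rho> = 1 - 1 / (3 * real n)"
    define G where "G = (1/2) ^ 11 * (exp (\<alpha> * real (n div 2)) - 1)"
    define x where "x = real n ^ 3 * exp (- (real L / (4 * real n)))"
    define y where "y = real n * (real (3 * (8 * l ^ 2)) ^ 2 * (real L * (4 / real n ^ 2))) ^ 2"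
    let ?l = "ln (real n)"
    have n: "72 \<le> n" and n0: "0 < real n" using elim(1) by linarith+
    have "0 < ?l" using elim(1) by simp
    then have l1: "1 < ?l" using elim(2) by simp
    have l: "?l \<le> real l" "real l \<le> ?l + 1" "0 < l" using l1 unfolding l_def by linarith+
    have m0: "28 * ln ?l \<le> real m0" "real m0 \<le> 28 * ln ?l + 1" "0 < m0" using elim(2) unfolding m0_def by linarith+
    have m0m: "m0 \<le> m n" using elim(7) by (simp add: m0_def nat_le_iff ceiling_le_iff)
    have l2: "?l ^ 2 \<le> real l ^ 2" "real l ^ 2 \<le> (?l + 1) ^ 2" using l l1 by (intro power_mono; simp)+
    have Ln: "real L / real n = real l ^ 2" using n0 by (simp add: L_def)
    have "128 * real l ^ 2 \<le> real n" using l2 elim(4) by linarith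
    then have "real n * (128 * real l ^ 2) \<le> real n * real n" using n0 by (intro mult_left_mono) auto
    then have "real (128 * L) \<le> real (n ^ 2)" by (simp add: L_def power2_eq_square algebra_simps)
    then have L128: "128 * L \<le> n ^ 2" by (simp only: of_nat_le_iff)
    have xle: "x \<le> real n ^ 3 * exp (- (?l ^ 2 / 4))"
    proof -
      have eq: "real L / (4 * real n) = real l ^ 2 / 4" using n0 by (simp add: L_def)
      show ?thesis unfolding x_def eq using l2(1) by (intro mult_left_mono) auto
    qed
    have yle: "y \<le> real n * (576 * (?l + 1) ^ 4 * (4 * (?l + 1) ^ 2 / real n)) ^ 2"
    proof -
      have "real (3 * (8 * l ^ 2)) ^ 2 = 576 * real l ^ 4" by (simp add: power_mult_distrib flip: power_mult)
      moreover have "real L * (4 / real n ^ 2) = 4 * real l ^ 2 / real n" using n0 by (simp add: L_def power2_eq_square)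
      ultimately have "y = real n * (576 * real l ^ 4 * (4 * real l ^ 2 / real n)) ^ 2" by (simp add: y_def)
      also have "\<dots> \<le> real n * (576 * (?l + 1) ^ 4 * (4 * (?l + 1) ^ 2 / real n)) ^ 2"
        using l l1 n0 by (intro mult_left_mono power_mono mult_mono divide_right_mono) auto
      finally show ?thesis .
    qed
    have "?P n (?bad n) \<le> real n * (2 ^ 11 * \<rho> ^ L) + (real L / real m0 + 1) * (2 * (exp \<alpha> - 1) / G)
      + real n * x + real (3 * (8 * l ^ 2)) * y + 2 ^ n * (63/64) ^ L"
      unfolding L_def \<rho>_def \<alpha>_def G_def x_def y_def
      by (rule hamilton_failure_bound[OF n m0(3) m0m l(3)])
        (use L128 xle yle elim(5,6) strat in \<open>auto simp: L_def x_def y_def\<close>)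
    also have "\<dots> \<le> \<delta> n"
      unfolding \<delta>_def
    proof (intro add_mono)
      have "\<rho> ^ L \<le> exp (- (1 / (3 * real n) * real L))"
        unfolding \<rho>_def using n by (intro one_minus_power_le_exp) simp
      also have "1 / (3 * real n) * real L = real l ^ 2 / 3" using n0 by (simp add: L_def)
      also have "exp (- (real l ^ 2 / 3)) \<le> exp (- (?l ^ 2 / 3))" using l2 by simp
      finally show "real n * (2 ^ 11 * \<rho> ^ L) \<le> real n * (2 ^ 11 * exp (- (?l ^ 2 / 3)))"
        by (intro mult_left_mono) auto
    next
      have \<alpha>: "0 \<le> \<alpha>" "\<alpha> \<le> 1" using m0 elim(3) n0 by (simp_all add: \<alpha>_def field_simps)
      have "exp \<alpha> \<le> 1 + \<alpha> + \<alpha> ^ 2" using \<alpha> by (rule exp_bound)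
      also have "\<alpha> ^ 2 \<le> \<alpha>" using \<alpha> by (simp add: power2_eq_square mult_left_le_one_le)
      finally have ea: "2 * (exp \<alpha> - 1) \<le> 4 * \<alpha>" by simp
      have "(real L / real m0 + 1) * (2 * (exp \<alpha> - 1)) \<le> (real L / real m0 + 1) * (4 * \<alpha>)"
        using ea by (intro mult_left_mono) auto
      \<comment> \<open>\<open>m0\<close> cancels: Breaker has about \<open>L / m0\<close> edges,
        and each costs an amount proportional to \<alpha>, that is, to \<open>m0\<close>.\<close>
      also have "\<dots> = 4 * (real l ^ 2 / 3 + \<alpha>)" using n0 m0 by (simp add: L_def \<alpha>_def field_simps)
      also have "\<dots> \<le> 4 * ((?l + 1) ^ 2 + 1)" using l2(2) \<alpha>(2) zero_le_power2[of "real l"] by argo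
      finally have num: "(real L / real m0 + 1) * (2 * (exp \<alpha> - 1)) \<le> 4 * ((?l + 1) ^ 2 + 1)" .
      \<comment> \<open>The fraction 3/7 absorbs the rounding in \<open>n div 2\<close> and cancels
        the 3 in the denominator of \<alpha>.\<close>
      have "3 * real n / 7 \<le> real (n div 2)" using n by linarith
      then have "\<alpha> * (3 * real n / 7) \<le> \<alpha> * real (n div 2)" using \<alpha> by (intro mult_left_mono) auto
      then have "real m0 / 7 \<le> \<alpha> * real (n div 2)" using n0 by (simp add: \<alpha>_def)
      then have "4 * ln ?l \<le> \<alpha> * real (n div 2)" using m0 by linarith
      then have "exp (4 * ln ?l) \<le> exp (\<alpha> * real (n div 2))" by simp
      also have "exp (4 * ln ?l) = ?l ^ 4" using l1 exp_of_nat_mult[of 4 "ln ?l"] by simp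
      finally have G: "(1/2) ^ 11 * (?l ^ 4 - 1) \<le> G" unfolding G_def by (intro mult_left_mono) auto
      have l41: "0 < ?l ^ 4 - 1" using l1 one_less_power[of ?l 4] by simp
      have "(real L / real m0 + 1) * (2 * (exp \<alpha> - 1) / G) = (real L / real m0 + 1) * (2 * (exp \<alpha> - 1)) / G" by simp
      also have "\<dots> \<le> 4 * ((?l + 1) ^ 2 + 1) / ((1/2) ^ 11 * (?l ^ 4 - 1))"
        using num G l41 by (intro frac_le) auto
      also have "\<dots> = 8192 * ((?l + 1) ^ 2 + 1) / (?l ^ 4 - 1)" using l41 by (simp add: field_simps)
      finally show "(real L / real m0 + 1) * (2 * (exp \<alpha> - 1) / G) \<le> 8192 * ((?l + 1) ^ 2 + 1) / (?l ^ 4 - 1)" .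
    next
      show "real n * x \<le> real n * (real n ^ 3 * exp (- (?l ^ 2 / 4)))" using xle by (intro mult_left_mono) auto
    next
      have "0 \<le> y" by (simp add: y_def)
      then show "real (3 * (8 * l ^ 2)) * y \<le> 24 * (?l + 1) ^ 2 * (real n * (576 * (?l + 1) ^ 4 * (4 * (?l + 1) ^ 2 / real n)) ^ 2)"
        using l2 yle by (intro mult_mono) auto
    next
      have "(63/64 :: real) ^ L \<le> exp (- (1/64 * real L))" using one_minus_power_le_exp[of "1/64" L] by simp
      also have "\<dots> \<le> exp (- (real n * ?l ^ 2 / 64))" using l2(1) n0 by (simp add: L_def)
      finally show "2 ^ n * (63/64) ^ L \<le> 2 ^ n * exp (- (real n * ?l ^ 2 / 64))" by (intro mult_left_mono) auto
    qed
    finally show ?case .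
  qed
  have lower: "\<forall>\<^sub>F n in sequentially. 0 \<le> ?P n (?bad n)" by simp
  have "\<delta> \<longlonglongrightarrow> 0" unfolding \<delta>_def by (rule failure_terms_tendsto_zero)
  then have lim: "(\<lambda>n. ?P n (?bad n)) \<longlonglongrightarrow> 0" by (rule tendsto_sandwich[OF lower upper tendsto_const])
  have "?P n (?good n) = 1 - ?P n (?bad n)" for n
    using measure_pmf.prob_compl[of "?bad n" "random_maker_game n (m n) (\<sigma> n)"]
    by (simp add: Compl_eq_Diff_UNIV[symmetric] Collect_neg_eq[symmetric])
  then show "(\<lambda>n. ?P n (?good n)) \<longlonglongrightarrow> 1" using tendsto_diff[OF tendsto_const lim, of 1] by simp
qed

end
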